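(* Let $d\ge 2$. For any parameter $\boldsymbol{\alpha}=(\alpha_1,\dots,\alpha_d)^\top$ with all $\alpha_i>0$, the Dirichlet distribution $\mathrm{Dir}(\boldsymbol{\alpha})$ is sub-Gaussian (as a random vector) with optimal proxy variance $\sigma_{\text{opt}}^2(\boldsymbol{\alpha})$ given by $$\sigma_{\text{opt}}^2(\boldsymbol{\alpha})=\sigma_{\text{opt}}^2(\alpha_{\max},\,\bar{\boldsymbol{\alpha}}-\alpha_{\max}),\qquad\text{where}\quad \alpha_{\max}=\max_{1\le i\le d}\{\alpha_i\},\quad \bar{\boldsymbol{\alpha}}=\sum_{i=1}^d\alpha_i,$$ and where $\sigma_{\text{opt}}^2(a,b)$ denotes the optimal proxy variance of the $\mathrm{Beta}(a,b)$ distribution.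
   Context: A real random variable $X$ with finite mean $\mu=\mathbb{E}[X]$ is $\sigma^2$-sub-Gaussian (with $\sigma^2$ called a proxy variance) if $\mathbb{E}[\exp(\lambda(X-\mu))]\le\exp(\lambda^2\sigma^2/2)$ for all $\lambda\in\mathbb{R}$. Its optimal proxy variance is the minimum of all $\sigma^2\ge 0$ for which $X$ is $\sigma^2$-sub-Gaussian. Sub-Gaussian vectors are defined as follows. A random $d$-dimensional vector $\boldsymbol{X}$ with finite mean $\boldsymbol{\mu}=\mathbb{E}[\boldsymbol{X}]$ is $\sigma^2$-sub-Gaussian if the random variable $\boldsymbol{u}^\top\boldsymbol{X}$ is $\sigma^2$-sub-Gaussian for any unit vector $\boldsymbol{u}$ in the simplex $\mathcal{S}^{d-1}=\{\boldsymbol{u}\in[0,1]^d : \sum_{i=1}^d u_i=1\}$. The definition adds that this is equivalent to saying that $$\mathbb{E}[\exp(\boldsymbol{\lambda}^\top(\boldsymbol{X}-\boldsymbol{\mu}))]\le\exp\left(\frac{\|\boldsymbol{\lambda}\|^2\sigma^2}{2}\right)\quad\text{for all }\boldsymbol{\lambda}\in\mathbb{R}^d,$$ where $\|\boldsymbol{\lambda}\|^2=\sum_{i=1}^d\lambda_i^2$. The optimal proxy variance of a random vector is the smallest $\sigma^2\ge 0$ for which it is $\sigma^2$-sub-Gaussian. $\mathrm{Dir}(\boldsymbol{\alpha})$ is the distribution on the simplex $\mathcal{S}^{d-1}$ with density $f(x_1,\dots,x_d;\alpha_1,\dots,\alpha_d)=\frac{1}{B(\boldsymbol{\alpha})}\prod_{i=1}^d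 x_i^{\alpha_i-1}$, where $B(\boldsymbol{\alpha})=\frac{1}{\Gamma(\bar{\boldsymbol{\alpha}})}\prod_{i=1}^d\Gamma(\alpha_i)$. $\mathrm{Beta}(a,b)$, $a,b>0$, is the distribution on $[0,1]$ with density $\frac{\Gamma(a+b)}{\Gamma(a)\Gamma(b)}x^{a-1}(1-x)^{b-1}$. Its optimal proxy variance is given, for any $a,b>0$, by $$\sigma_{\text{opt}}^2(a,b)=\frac{a}{(a+b)x_0}\left(\frac{{}_1F_1(a+1;a+b+1;x_0)}{{}_1F_1(a;a+b;x_0)}-1\right),$$ where $x_0$ is the unique solution of the equation $$\ln({}_1F_1(a;a+b;x_0))=\frac{a x_0}{2(a+b)}\left(1+\frac{{}_1F_1(a+1;a+b+1;x_0)}{{}_1F_1(a;a+b;x_0)}\right);$$ for $a=b$ one has $\sigma_{\text{opt}}^2(a,a)=\frac{1}{4(2a+1)}$. Here ${}_1F_1(p;q;x)=\sum_{j\ge0}\frac{(p)_j}{(q)_j}\frac{x^j}{j!}$ is the confluent hypergeometric function, with $(p)_j=p(p+1)\cdots(p+j-1)$, $(p)_0=1$. *)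

theory Defs
  imports "HOL-Probability.Probability"
begin

text \<open>The parameter \<open>s\<close> below stands for the proxy variance \<open>\<sigma>\<^sup>2\<close>.
  Integrability is part of the condition because the Bochner integral of a non-integrable
  function is 0, which would satisfy the bound.\<close>

definition sub_gaussian :: "'a measure \<Rightarrow> ('a \<Rightarrow> real) \<Rightarrow> real \<Rightarrow> bool" where
  "sub_gaussian M X s \<longleftrightarrow>
     prob_space M \<and> integrable M X \<and>
     (\<forall>l::real. integrable M (\<lambda>\<omega>. exp (l * (X \<omega> - integral\<^sup>L M X))) \<and>
        integral\<^sup>L M (\<lambda>\<omega>. exp (l * (X \<omega> - integral\<^sup>L M X))) \<le> exp (l\<^sup>2 * s / 2))"

definition is_optimal_proxy_variance :: "'a measure \<Rightarrow> ('a \<Rightarrow> real) \<Rightarrow> real \<Rightarrow> bool" where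
  "is_optimal_proxy_variance M X s \<longleftrightarrow>
     0 \<le> s \<and> sub_gaussian M X s \<and> (\<forall>t\<ge>0. sub_gaussian M X t \<longrightarrow> s \<le> t)"

text \<open>Vectors in \<open>\<real>\<^sup>d\<close> are functions on \<open>{..<d}\<close>, extended by \<open>undefined\<close>
  outside, as in product measures; \<open>real ^ 'n\<close> is avoided because the Dirichlet density
  refers to \<open>d - 1\<close> free coordinates.\<close>

definition prob_simplex :: "nat \<Rightarrow> (nat \<Rightarrow> real) set" where
  "prob_simplex d = {u \<in> {..<d} \<rightarrow>\<^sub>E {0..1}. (\<Sum>i<d. u i) = 1}"

text \<open>The directions \<open>u\<close> are the vectors of the simplex, that is, the nonnegative vectors
  that are unit for the sum norm. Bounding
  \<open>E[exp (\<lambda> \<bullet> (X - \<mu>))]\<close> by \<open>exp (\<parallel>\<lambda>\<parallel>\<^sup>2 s / 2)\<close> in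
  the Euclidean norm for all \<open>\<lambda>\<close> is a different condition: for \<open>X = (B, 1 - B)\<close>
  it doubles the optimal \<open>s\<close>.\<close>

definition sub_gaussian_vec :: "nat \<Rightarrow> 'a measure \<Rightarrow> ('a \<Rightarrow> nat \<Rightarrow> real) \<Rightarrow> real \<Rightarrow> bool" where
  "sub_gaussian_vec d M X s \<longleftrightarrow>
     prob_space M \<and> X \<in> measurable M (\<Pi>\<^sub>M i\<in>{..<d}. borel) \<and>
     (\<forall>i<d. integrable M (\<lambda>\<omega>. X \<omega> i)) \<and>
     (\<forall>u\<in>prob_simplex d. sub_gaussian M (\<lambda>\<omega>. \<Sum>i<d. u i * X \<omega> i) s)"

definition is_optimal_proxy_variance_vec ::
    "nat \<Rightarrow> 'a measure \<Rightarrow> ('a \<Rightarrow> nat \<Rightarrow> real) \<Rightarrow> real \<Rightarrow> bool" where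
  "is_optimal_proxy_variance_vec d M X s \<longleftrightarrow>
     0 \<le> s \<and> sub_gaussian_vec d M X s \<and> (\<forall>t\<ge>0. sub_gaussian_vec d M X t \<longrightarrow> s \<le> t)"

definition beta_distribution :: "real \<Rightarrow> real \<Rightarrow> real measure" where
  "beta_distribution a b = density lborel (\<lambda>x. ennreal (indicator {0..1} x *
     (Gamma (a + b) / (Gamma a * Gamma b) * x powr (a - 1) * (1 - x) powr (b - 1))))"

definition beta_optimal_proxy_variance :: "real \<Rightarrow> real \<Rightarrow> real" where
  "beta_optimal_proxy_variance a b =
     (THE s. is_optimal_proxy_variance (beta_distribution a b) (\<lambda>x. x) s)"

text \<open>The reference measure for the Dirichlet density: Lebesgue measure in the first
  \<open>d - 1\<close> coordinates, carried to the hyperplane of coordinate sum 1 by computing the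
  last coordinate.\<close>

definition hyperplane_lebesgue :: "nat \<Rightarrow> (nat \<Rightarrow> real) measure" where
  "hyperplane_lebesgue d = distr (\<Pi>\<^sub>M i\<in>{..<d - 1}. lborel) (\<Pi>\<^sub>M i\<in>{..<d}. borel)
     (\<lambda>x. \<lambda>i\<in>{..<d}. if i = d - 1 then 1 - (\<Sum>j<d - 1. x j) else x i)"

definition multivariate_Beta :: "nat \<Rightarrow> (nat \<Rightarrow> real) \<Rightarrow> real" where
  "multivariate_Beta d \<alpha> = (\<Prod>i<d. Gamma (\<alpha> i)) / Gamma (\<Sum>i<d. \<alpha> i)"

definition dirichlet :: "nat \<Rightarrow> (nat \<Rightarrow> real) \<Rightarrow> (nat \<Rightarrow> real) measure" where
  "dirichlet d \<alpha> = density (hyperplane_lebesgue d) (\<lambda>x. ennreal (indicator (prob_simplex d) x *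
     (1 / multivariate_Beta d \<alpha> * (\<Prod>i<d. x i powr (\<alpha> i - 1)))))"

end

theory Submission
  imports Defs
begin

text \<open>A coordinate \<open>X\<^sub>i\<close> of a Dirichlet vector has the moments, hence the moment generating
  function, of \<open>Beta(\<alpha>\<^sub>i, s - \<alpha>\<^sub>i)\<close>, where \<open>s\<close> is the sum of all parameters. By Jensen's
  inequality the claim reduces to comparing the distributions \<open>Beta(a, s - a)\<close> for fixed
  \<open>s\<close>: the optimal proxy variance is symmetric under \<open>a \<mapsto> s - a\<close> and has to be
  shown nondecreasing in \<open>a \<le> s / 2\<close>.

  Put \<open>K\<^sub>a(x) = ln 1F1(a; s; x) - a x / s\<close> for \<open>x > 0\<close>. If \<open>a \<ge> s / 2\<close>, then
  \<open>K\<^sub>a(x) \<le> x\<^sup>2 Var / 2\<close>, and every proxy variance is at least the variance. If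
  \<open>a < s / 2\<close>, the optimal proxy variance is the supremum of \<open>2 K\<^sub>a(x) / x\<^sup>2\<close>. At a maximiser
  \<open>l > 0\<close> one has \<open>2 K\<^sub>a(l) = l K\<^sub>a'(l)\<close>, and this relation implies
  \<open>1F1(a + s h; s; l) \<ge> (1 + h l) 1F1(a; s; l)\<close> for all admissible \<open>h > 0\<close>. Since
  \<open>ln (1 + h l) \<ge> h l - (h l)\<^sup>2 / 2\<close>, passing from \<open>a\<close> to \<open>a + s h\<close> lowers the supremum by
  at most \<open>h\<^sup>2\<close>. Dividing the way from \<open>a\<close> to \<open>a' \<le> s / 2\<close> into \<open>N\<close> equal steps costs
  \<open>O(1 / N)\<close> in total, which gives monotonicity.\<close>

section \<open>The confluent hypergeometric function\<close>

definition kummer_coeff :: "real \<Rightarrow> real \<Rightarrow> nat \<Rightarrow> real" where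
  "kummer_coeff a s n = pochhammer a n / (pochhammer s n * fact n)"

definition kummer :: "real \<Rightarrow> real \<Rightarrow> real \<Rightarrow> real" where
  "kummer a s x = (\<Sum>n. kummer_coeff a s n * x ^ n)"

definition kummer_deriv :: "real \<Rightarrow> real \<Rightarrow> real \<Rightarrow> real" where
  "kummer_deriv a s x = (\<Sum>n. diffs (kummer_coeff a s) n * x ^ n)"

definition kummer_deriv2 :: "real \<Rightarrow> real \<Rightarrow> real \<Rightarrow> real" where
  "kummer_deriv2 a s x = (\<Sum>n. diffs (diffs (kummer_coeff a s)) n * x ^ n)"

lemma pochhammer_mono_real:
  fixes a s :: real
  assumes "0 < a" "a \<le> s"
  shows "pochhammer a n \<le> pochhammer s n"
proof (induction n)
  case (Suc n)
  have "pochhammer a n * (a + n) \<le> pochhammer s n * (s + n)"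
    using Suc assms pochhammer_pos[of s n] by (intro mult_mono) auto
  then show ?case by (simp add: pochhammer_Suc)
qed simp

locale kummer_params =
  fixes a s :: real
  assumes a_pos: "0 < a" and a_less: "a < s"
begin

lemma s_pos: "0 < s" using a_pos a_less by simp

lemma kummer_coeff_pos: "0 < kummer_coeff a s n"
  using a_pos s_pos pochhammer_pos[of a n] pochhammer_pos[of s n]
  by (simp add: kummer_coeff_def)

text \<open>The ratio of consecutive coefficients, freed of denominators. This recurrence yields
  both Kummer's equation and the inequality M' < M for M = \<open>kummer a s\<close>.\<close>

lemma kummer_coeff_Suc:
  "(s + n) * (Suc n * kummer_coeff a s (Suc n)) = (a + n) * kummer_coeff a s n"
proof -
  have "kummer_coeff a s (Suc n) = (a + n) / ((s + n) * Suc n) * kummer_coeff a s n"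
    by (simp add: kummer_coeff_def pochhammer_Suc mult_ac del: of_nat_Suc)
  moreover have "s + n \<noteq> 0" using s_pos by linarith
  ultimately show ?thesis by (simp del: of_nat_Suc)
qed

text \<open>Comparison with the exponential series gives convergence everywhere, and with it
  termwise differentiation at every point.\<close>

lemma kummer_coeff_le: "kummer_coeff a s n \<le> 1 / fact n"
proof -
  have "pochhammer a n / pochhammer s n \<le> 1"
    using pochhammer_mono_real[of a s n] a_pos a_less pochhammer_pos[of s n] by simp
  then have "pochhammer a n / pochhammer s n / fact n \<le> 1 / fact n"
    by (intro divide_right_mono) auto
  then show ?thesis by (simp add: kummer_coeff_def)
qed

lemma summable_kummer: "summable (\<lambda>n. kummer_coeff a s n * x ^ n)"
proof (rule summable_comparison_test')
  show "summable (\<lambda>n. \<bar>x\<bar> ^ n / fact n)"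
    using summable_exp[of "\<bar>x\<bar>"] by (simp add: field_simps)
  show "norm (kummer_coeff a s n * x ^ n) \<le> \<bar>x\<bar> ^ n / fact n" if "n \<ge> 0" for n
    using mult_right_mono[OF kummer_coeff_le[of n], of "\<bar>x\<bar> ^ n"] kummer_coeff_pos[of n]
    by (simp add: abs_mult power_abs)
qed

lemma summable_kummer_deriv: "summable (\<lambda>n. diffs (kummer_coeff a s) n * x ^ n)"
  by (rule termdiff_converges_all) (rule summable_kummer)

lemma summable_kummer_deriv2: "summable (\<lambda>n. diffs (diffs (kummer_coeff a s)) n * x ^ n)"
  by (rule termdiff_converges_all) (rule summable_kummer_deriv)

lemma DERIV_kummer: "(kummer a s has_real_derivative kummer_deriv a s x) (at x)"
  unfolding kummer_def[abs_def] kummer_deriv_def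
  by (rule termdiffs_strong_converges_everywhere) (rule summable_kummer)

lemma DERIV_kummer_deriv: "(kummer_deriv a s has_real_derivative kummer_deriv2 a s x) (at x)"
  unfolding kummer_deriv_def[abs_def] kummer_deriv2_def
  by (rule termdiffs_strong_converges_everywhere) (rule summable_kummer_deriv)

lemma isCont_kummer_deriv2: "isCont (kummer_deriv2 a s) x"
  unfolding kummer_deriv2_def[abs_def]
  by (rule isCont_powser_converges_everywhere) (rule summable_kummer_deriv2)

lemma kummer_0: "kummer a s 0 = 1"
  using powser_zero[of "kummer_coeff a s"] by (simp add: kummer_def kummer_coeff_def)

lemma kummer_deriv_0: "kummer_deriv a s 0 = a / s"
  using powser_zero[of "diffs (kummer_coeff a s)"]
  by (simp add: kummer_deriv_def diffs_def kummer_coeff_def)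

lemma kummer_deriv2_0: "kummer_deriv2 a s 0 = a * (a + 1) / (s * (s + 1))"
  using powser_zero[of "diffs (diffs (kummer_coeff a s))"]
  by (simp add: kummer_deriv2_def diffs_def kummer_coeff_def pochhammer_Suc)

lemma kummer_pos: "0 < kummer a s x" if "0 \<le> x"
  unfolding kummer_def
  by (rule suminf_pos2[OF summable_kummer, where i = 0])
     (use kummer_coeff_pos that in \<open>simp_all add: less_imp_le\<close>)

lemma kummer_deriv_pos: "0 < kummer_deriv a s x" if "0 \<le> x"
  unfolding kummer_deriv_def
  by (rule suminf_pos2[OF summable_kummer_deriv, where i = 0])
     (use kummer_coeff_pos that in \<open>simp_all add: diffs_def less_imp_le\<close>)

text \<open>The n-th coefficient of the derivative is (a + n) / (s + n) times that of the function,
  and a < s; the term n = 0 makes the inequality strict.\<close>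

lemma kummer_deriv_less: "kummer_deriv a s x < kummer a s x" if "0 \<le> x"
proof -
  have less: "diffs (kummer_coeff a s) n < kummer_coeff a s n" for n
  proof -
    have "(s + n) * diffs (kummer_coeff a s) n < (s + n) * kummer_coeff a s n"
      using kummer_coeff_Suc[of n] kummer_coeff_pos[of n] a_less by (simp add: diffs_def)
    then show ?thesis using s_pos by simp
  qed
  have "0 < (\<Sum>n. kummer_coeff a s n * x ^ n - diffs (kummer_coeff a s) n * x ^ n)"
  proof (rule suminf_pos2[OF summable_diff[OF summable_kummer summable_kummer_deriv], where i = 0])
    show "0 \<le> kummer_coeff a s n * x ^ n - diffs (kummer_coeff a s) n * x ^ n" for n
      using less[of n] that by (simp add: mult_right_mono)
  qed (use less[of 0] in simp)
  also have "\<dots> = kummer a s x - kummer_deriv a s x"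
    unfolding kummer_def kummer_deriv_def
    by (rule suminf_diff[symmetric, OF summable_kummer summable_kummer_deriv])
  finally show ?thesis by simp
qed

lemma kummer_ode:
  "x * kummer_deriv2 a s x + (s - x) * kummer_deriv a s x = a * kummer a s x"
proof -
  let ?c = "kummer_coeff a s"
  \<comment> \<open>Multiplying a derivative series by x puts the coefficient n * e n at x^n.
    Applied to the series of M and of M', this brings all terms of the equation to the same power of
    x.\<close>
  have shift: "(\<lambda>n. real n * e n * x ^ n) sums (x * (\<Sum>n. diffs e n * x ^ n))"
    if "\<And>y. summable (\<lambda>n. e n * y ^ n)" for e :: "nat \<Rightarrow> real"
  proof -
    have "(\<lambda>n. diffs e n * x ^ n) sums (\<Sum>n. diffs e n * x ^ n)"
      using termdiff_converges_all[OF that] by (simp add: summable_sums)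
    from sums_mult[OF this, of x]
    have "(\<lambda>n. real (Suc n) * e (Suc n) * x ^ Suc n) sums (x * (\<Sum>n. diffs e n * x ^ n))"
      by (simp add: diffs_def algebra_simps)
    from iffD1[OF sums_Suc_iff this] show ?thesis by simp
  qed
  have "(\<lambda>n. real n * diffs ?c n * x ^ n + s * (diffs ?c n * x ^ n) - real n * ?c n * x ^ n)
      sums (x * kummer_deriv2 a s x + s * kummer_deriv a s x - x * kummer_deriv a s x)"
    unfolding kummer_deriv2_def kummer_deriv_def
    by (intro sums_add sums_diff shift sums_mult summable_sums summable_kummer
        summable_kummer_deriv)
  also have "(\<lambda>n. real n * diffs ?c n * x ^ n + s * (diffs ?c n * x ^ n) - real n * ?c n * x ^ n)
      = (\<lambda>n. a * (?c n * x ^ n))"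
  proof
    fix n
    have "real n * diffs ?c n + s * diffs ?c n - real n * ?c n = a * ?c n"
      using kummer_coeff_Suc[of n] by (simp add: diffs_def algebra_simps)
    then show "real n * diffs ?c n * x ^ n + s * (diffs ?c n * x ^ n) - real n * ?c n * x ^ n
      = a * (?c n * x ^ n)" by (metis (no_types, opaque_lifting) distrib_right left_diff_distrib mult.assoc)
  qed
  finally have "(\<lambda>n. a * (?c n * x ^ n)) sums
    (x * kummer_deriv2 a s x + s * kummer_deriv a s x - x * kummer_deriv a s x)" .
  moreover have "(\<lambda>n. a * (?c n * x ^ n)) sums (a * kummer a s x)"
    unfolding kummer_def by (intro sums_mult summable_sums summable_kummer)
  ultimately show ?thesis
    using sums_unique2 by (fastforce simp: algebra_simps)
qed

section \<open>Logarithmic derivatives\<close>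

text \<open>Let \<open>M\<close> be the function \<open>kummer a s\<close>, \<open>\<phi> = M' / M\<close> (\<open>tilted_mean\<close>) and
  \<open>D = \<phi>'\<close> (\<open>tilted_var\<close>). Kummer's equation becomes
  \<open>x D = x \<phi> (1 - \<phi>) - s (\<phi> - a / s)\<close>; differentiating it once more gives
  \<open>x D' + (s + drift) D = s excess / x\<close>, and \<open>weight\<close> is the integrating factor of
  this operator. The function \<open>gap\<close> is the derivative of \<open>x excess - 2 cgf\<close>, which
  vanishes exactly where \<open>cgf x / x\<^sup>2\<close> is stationary.\<close>

definition tilted_mean :: "real \<Rightarrow> real" where
  "tilted_mean x = kummer_deriv a s x / kummer a s x"

definition tilted_var :: "real \<Rightarrow> real" where
  "tilted_var x = kummer_deriv2 a s x / kummer a s x - (tilted_mean x)\<^sup>2"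

definition cgf :: "real \<Rightarrow> real" where
  "cgf x = ln (kummer a s x) - a / s * x"

definition excess :: "real \<Rightarrow> real" where
  "excess x = tilted_mean x - a / s"

definition gap :: "real \<Rightarrow> real" where
  "gap x = x * tilted_var x - excess x"

definition weight :: "real \<Rightarrow> real" where
  "weight x = x powr s * (kummer a s x)\<^sup>2 * exp (- x)"

definition drift :: "real \<Rightarrow> real" where
  "drift x = x * (2 * tilted_mean x - 1)"

lemma cgf_0: "cgf 0 = 0"
  by (simp add: cgf_def kummer_0)

lemma tilted_mean_0: "tilted_mean 0 = a / s"
  by (simp add: tilted_mean_def kummer_0 kummer_deriv_0)

lemma excess_0: "excess 0 = 0"
  by (simp add: excess_def tilted_mean_0)

lemma tilted_var_0: "tilted_var 0 = a / s * (1 - a / s) / (s + 1)"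
proof -
  have "a * (a + 1) / (s * (s + 1)) - (a / s)\<^sup>2 =
      (a * (a + 1) * s - a\<^sup>2 * (s + 1)) / (s\<^sup>2 * (s + 1))"
    using s_pos by (simp add: divide_simps) (simp add: algebra_simps power2_eq_square)
  also have "\<dots> = a / s * (1 - a / s) / (s + 1)"
    using s_pos by (simp add: divide_simps) (simp add: algebra_simps power2_eq_square)
  finally have "a * (a + 1) / (s * (s + 1)) - (a / s)\<^sup>2 = a / s * (1 - a / s) / (s + 1)" .
  then show ?thesis
    by (simp add: tilted_var_def tilted_mean_0 kummer_0 kummer_deriv2_0)
qed

lemma tilted_mean_pos: "0 \<le> x \<Longrightarrow> 0 < tilted_mean x"
  by (simp add: tilted_mean_def kummer_pos kummer_deriv_pos)

lemma tilted_mean_less_1: "0 \<le> x \<Longrightarrow> tilted_mean x < 1"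
  by (simp add: tilted_mean_def kummer_pos kummer_deriv_less)

lemma DERIV_tilted_mean: "(tilted_mean has_real_derivative tilted_var x) (at x)" if "0 \<le> x"
  unfolding tilted_mean_def[abs_def] tilted_var_def
  by (rule derivative_eq_intros DERIV_kummer DERIV_kummer_deriv refl)+
     (use kummer_pos[OF that] in \<open>simp_all add: field_simps power2_eq_square\<close>)

lemma DERIV_excess: "(excess has_real_derivative tilted_var x) (at x)" if "0 \<le> x"
  unfolding excess_def[abs_def]
  using DERIV_diff[OF DERIV_tilted_mean[OF that] DERIV_const] by simp

lemma DERIV_cgf: "(cgf has_real_derivative excess x) (at x)" if "0 \<le> x"
  unfolding cgf_def[abs_def] excess_def tilted_mean_def
  by (rule derivative_eq_intros DERIV_kummer refl kummer_pos that)+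
     (use kummer_pos[OF that] in simp)

lemma tilted_var_eq:
  "x * tilted_var x = x * tilted_mean x * (1 - tilted_mean x) - s * excess x" if "0 \<le> x"
proof -
  have "x * (kummer_deriv2 a s x / kummer a s x) =
      (a * kummer a s x - (s - x) * kummer_deriv a s x) / kummer a s x"
    using kummer_ode[of x] by (simp add: algebra_simps)
  also have "\<dots> = a - (s - x) * tilted_mean x"
    using kummer_pos[OF that] by (simp add: tilted_mean_def diff_divide_distrib)
  finally show ?thesis
    using s_pos unfolding tilted_var_def excess_def
    by (simp add: algebra_simps power2_eq_square)
qed

lemma isCont_tilted_var: "isCont tilted_var x" if "0 \<le> x"
  unfolding tilted_var_def[abs_def] tilted_mean_def[abs_def]
  using kummer_pos[OF that] DERIV_isCont[OF DERIV_kummer] DERIV_isCont[OF DERIV_kummer_deriv]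
    isCont_kummer_deriv2
  by (intro continuous_intros) auto

lemma DERIV_tilted_var:
  "(tilted_var has_real_derivative (s * excess x / x - (s + drift x) * tilted_var x) / x) (at x)"
  if "0 < x"
proof -
  let ?g = "\<lambda>x. tilted_mean x * (1 - tilted_mean x) - s * (excess x / x)"
  have "(?g has_real_derivative
      (tilted_var x * (1 - tilted_mean x) + - tilted_var x * tilted_mean x
        - s * ((tilted_var x * x - excess x * 1) / (x * x)))) (at x)"
    using that
    by (intro DERIV_diff DERIV_mult DERIV_cmult DERIV_divide DERIV_ident DERIV_excess
        DERIV_tilted_mean DERIV_cong[OF DERIV_diff[OF DERIV_const DERIV_tilted_mean]]) auto
  also have "tilted_var x * (1 - tilted_mean x) + - tilted_var x * tilted_mean x
        - s * ((tilted_var x * x - excess x * 1) / (x * x)) =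
      (s * excess x / x - (s + drift x) * tilted_var x) / x"
    using that by (simp add: drift_def divide_simps) (simp add: algebra_simps)
  finally have "(?g has_real_derivative
      (s * excess x / x - (s + drift x) * tilted_var x) / x) (at x)" .
  \<comment> \<open>The quotient form of \<open>tilted_var\<close> is available for positive
    arguments only, so its derivative is transferred on a neighbourhood of x.\<close>
  moreover have "eventually (\<lambda>y. tilted_var y = ?g y) (nhds x)"
  proof (rule eventually_nhds_in_open[of "{0<..}", THEN eventually_mono])
    show "tilted_var y = ?g y" if "y \<in> {0<..}" for y
      using tilted_var_eq[of y] that by (simp add: field_simps)
  qed (use that in auto)
  ultimately show ?thesis
    by (subst DERIV_cong_ev[OF refl _ refl]) auto
qed

text \<open>The power x^s is an integrating factor of the operator g -> x g' + s g. This serves for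
  \<open>excess\<close>, \<open>gap\<close>, \<open>weight\<close> and the Wronskian
  \<open>P\<close> below.\<close>

lemma DERIV_powr_times:
  assumes "0 < x" "(g has_real_derivative g') (at x)" "x * g' + s * g x = r"
  shows "((\<lambda>x. x powr s * g x) has_real_derivative x powr s * r / x) (at x)"
proof -
  have "((\<lambda>x. x powr s * g x) has_real_derivative
      s * x powr (s - 1) * g x + g' * x powr s) (at x)"
    using assms by (intro DERIV_mult has_real_derivative_powr)
  also have "s * x powr (s - 1) * g x + g' * x powr s = x powr s * r / x"
    unfolding assms(3)[symmetric] using assms(1) by (simp add: powr_diff field_simps)
  finally show ?thesis .
qed

lemma DERIV_weight:
  "(weight has_real_derivative weight x * (s + drift x) / x) (at x)" if "0 < x"
proof -
  let ?M = "kummer a s x" and ?M' = "kummer_deriv a s x"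
  have M: "0 < ?M" using kummer_pos that by simp
  have "((\<lambda>x. (kummer a s x)\<^sup>2 * exp (- x)) has_real_derivative
      (2 * ?M * ?M' - ?M\<^sup>2) * exp (- x)) (at x)"
    by (auto intro!: derivative_eq_intros DERIV_kummer simp: algebra_simps power2_eq_square)
  moreover have "x * ((2 * ?M * ?M' - ?M\<^sup>2) * exp (- x)) + s * (?M\<^sup>2 * exp (- x))
      = ?M\<^sup>2 * exp (- x) * (s + drift x)"
    using M by (simp add: drift_def tilted_mean_def algebra_simps power2_eq_square)
  ultimately have "((\<lambda>x. x powr s * ((kummer a s x)\<^sup>2 * exp (- x))) has_real_derivative
      x powr s * (?M\<^sup>2 * exp (- x) * (s + drift x)) / x) (at x)"
    by (rule DERIV_powr_times[OF that])
  then show ?thesis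
    unfolding weight_def[abs_def] by (simp only: mult.assoc)
qed

lemma DERIV_weight_times:
  assumes "0 < x" "(g has_real_derivative g') (at x)" "x * g' + (s + drift x) * g x = r"
  shows "((\<lambda>x. weight x * g x) has_real_derivative weight x * r / x) (at x)"
proof -
  have "((\<lambda>x. weight x * g x) has_real_derivative
      weight x * (s + drift x) / x * g x + g' * weight x) (at x)"
    using assms by (intro DERIV_mult DERIV_weight)
  also have "weight x * (s + drift x) / x * g x + g' * weight x = weight x * r / x"
    unfolding assms(3)[symmetric] using assms(1) by (simp add: field_simps)
  finally show ?thesis .
qed

lemma weight_pos: "0 < x \<Longrightarrow> 0 < weight x"
  using kummer_pos[of x] by (simp add: weight_def)

lemma weight_0: "weight 0 = 0"
  by (simp add: weight_def)

lemma continuous_on_powr_nonneg: "continuous_on {0..} (\<lambda>x::real. x powr s)"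
  using s_pos by (intro continuous_on_powr' continuous_intros) auto

lemma continuous_on_weight: "continuous_on {0..} weight"
  unfolding weight_def[abs_def]
  by (intro continuous_intros continuous_on_powr_nonneg continuous_at_imp_continuous_on ballI
      DERIV_isCont[OF DERIV_kummer])

lemma continuous_on_excess: "continuous_on {0..} excess"
  by (auto intro!: continuous_at_imp_continuous_on DERIV_isCont[OF DERIV_excess])

lemma continuous_on_tilted_var: "continuous_on {0..} tilted_var"
  by (auto intro!: continuous_at_imp_continuous_on isCont_tilted_var)

section \<open>Signs of the derivatives of the cumulant function\<close>

text \<open>By \<open>tilted_var_eq\<close>, x excess' + s excess equals x \<phi> (1 - \<phi>) > 0
  with \<phi> = \<open>tilted_mean\<close>, so x^s excess increases from its value 0 at 0.\<close>

lemma excess_pos: "0 < excess x" if "0 < x"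
proof -
  have "0 powr s * excess 0 < x powr s * excess x"
  proof (rule DERIV_pos_imp_increasing_open[OF that])
    fix y :: real assume "0 < y"
    have "((\<lambda>x. x powr s * excess x) has_real_derivative
        y powr s * (y * tilted_mean y * (1 - tilted_mean y)) / y) (at y)"
      by (rule DERIV_powr_times[OF \<open>0 < y\<close> DERIV_excess])
         (use \<open>0 < y\<close> tilted_var_eq[of y] in auto)
    moreover have "0 < y powr s * (y * tilted_mean y * (1 - tilted_mean y)) / y"
      using \<open>0 < y\<close> tilted_mean_pos[of y] tilted_mean_less_1[of y] by simp
    ultimately show "\<exists>y'. ((\<lambda>x. x powr s * excess x) has_real_derivative y') (at y) \<and> 0 < y'"
      by blast
  next
    show "continuous_on {0..x} (\<lambda>x. x powr s * excess x)"
      by (intro continuous_on_mult continuous_on_subset[OF continuous_on_powr_nonneg]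
          continuous_on_subset[OF continuous_on_excess]) auto
  qed
  then show ?thesis using that by (simp add: zero_less_mult_iff)
qed

text \<open>The product \<open>weight * tilted_var\<close> vanishes at 0 and is driven upwards by
  the positive term s excess / x.\<close>

lemma tilted_var_pos: "0 < tilted_var x" if "0 < x"
proof -
  have "weight 0 * tilted_var 0 < weight x * tilted_var x"
  proof (rule DERIV_pos_imp_increasing_open[OF that])
    fix y :: real assume "0 < y"
    have "((\<lambda>x. weight x * tilted_var x) has_real_derivative
        weight y * (s * excess y / y) / y) (at y)"
      by (rule DERIV_weight_times[OF \<open>0 < y\<close> DERIV_tilted_var[OF \<open>0 < y\<close>]])
         (use \<open>0 < y\<close> in simp)
    moreover have "0 < weight y * (s * excess y / y) / y"
      using \<open>0 < y\<close> weight_pos[of y] excess_pos[of y] s_pos by simp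
    ultimately show "\<exists>y'. ((\<lambda>x. weight x * tilted_var x) has_real_derivative y') (at y) \<and> 0 < y'"
      by blast
  next
    show "continuous_on {0..x} (\<lambda>x. weight x * tilted_var x)"
      by (intro continuous_on_mult continuous_on_subset[OF continuous_on_weight]
          continuous_on_subset[OF continuous_on_tilted_var]) auto
  qed
  then show ?thesis using weight_pos[OF that] by (simp add: weight_0 zero_less_mult_iff)
qed

lemma tilted_mean_mono: "tilted_mean x \<le> tilted_mean y" if "0 \<le> x" "x \<le> y"
proof (rule DERIV_nonneg_imp_nondecreasing[OF that(2)])
  fix z assume z: "x \<le> z" "z \<le> y"
  have "0 \<le> tilted_var z"
  proof (cases "z = 0")
    case True
    then show ?thesis using a_pos a_less by (simp add: tilted_var_0)
  next
    case False
    then show ?thesis using tilted_var_pos[of z] z that by simp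
  qed
  then show "\<exists>y. (tilted_mean has_real_derivative y) (at z) \<and> 0 \<le> y"
    using DERIV_tilted_mean[of z] z that by auto
qed

lemma tilted_mean_strict_mono: "tilted_mean x < tilted_mean y" if "0 \<le> x" "x < y"
proof (rule DERIV_pos_imp_increasing_open[OF that(2)])
  show "\<exists>y. (tilted_mean has_real_derivative y) (at z) \<and> 0 < y" if "x < z" for z
    using DERIV_tilted_mean[of z] tilted_var_pos[of z] that \<open>0 \<le> x\<close> by auto
  show "continuous_on {x..y} tilted_mean"
    using that by (auto intro!: continuous_at_imp_continuous_on DERIV_isCont[OF DERIV_tilted_mean])
qed

section \<open>Sign changes of the gap\<close>

text \<open>The factor 1 - 2 \<open>tilted_mean\<close> decides the sign of the derivative, and
  \<open>tilted_mean\<close> increases. So x^s gap rises while the mean is below 1/2 and falls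
  afterwards.\<close>

lemma DERIV_scaled_gap:
  "((\<lambda>x. x powr s * gap x) has_real_derivative
    y powr s * (y\<^sup>2 * (1 - 2 * tilted_mean y) * tilted_var y) / y) (at y)" if "0 < y"
proof (rule DERIV_powr_times[OF that])
  let ?D' = "(s * excess y / y - (s + drift y) * tilted_var y) / y"
  show "(gap has_real_derivative y * ?D') (at y)"
    unfolding gap_def[abs_def] using that
    by (intro DERIV_cong[OF DERIV_diff[OF DERIV_mult[OF DERIV_ident DERIV_tilted_var]
          DERIV_excess]]) auto
  show "y * (y * ?D') + s * gap y = y\<^sup>2 * (1 - 2 * tilted_mean y) * tilted_var y"
  proof -
    have "y * ?D' = s * excess y / y - (s + drift y) * tilted_var y" using that by simp
    then have "y * (y * ?D') = s * excess y - y * (s + drift y) * tilted_var y"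
      using that by (simp add: right_diff_distrib)
    then show ?thesis by (simp add: gap_def drift_def algebra_simps power2_eq_square)
  qed
qed

lemma continuous_on_gap: "continuous_on {0..} gap"
  unfolding gap_def[abs_def]
  by (intro continuous_intros continuous_on_excess continuous_on_tilted_var)

lemma continuous_on_scaled_gap: "0 \<le> x \<Longrightarrow> continuous_on {x..y} (\<lambda>x. x powr s * gap x)"
  by (intro continuous_on_mult continuous_on_subset[OF continuous_on_powr_nonneg]
      continuous_on_subset[OF continuous_on_gap]) auto

lemma gap_pos: "0 < gap x" if "0 < x" "tilted_mean x \<le> 1/2"
proof -
  have "0 powr s * gap 0 < x powr s * gap x"
  proof (rule DERIV_pos_imp_increasing_open[OF that(1)])
    fix y assume y: "0 < y" "y < x"
    then have "0 < y powr s * (y\<^sup>2 * (1 - 2 * tilted_mean y) * tilted_var y) / y"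
      using tilted_mean_strict_mono[of y x] tilted_var_pos[of y] that(2) by simp
    then show "\<exists>z. ((\<lambda>x. x powr s * gap x) has_real_derivative z) (at y) \<and> 0 < z"
      using DERIV_scaled_gap[OF y(1)] by blast
  qed (simp add: continuous_on_scaled_gap)
  then show ?thesis using that by (simp add: zero_less_mult_iff)
qed

lemma scaled_gap_antimono:
  "y powr s * gap y \<le> x powr s * gap x" if "0 \<le> x" "x \<le> y" "1/2 \<le> tilted_mean x"
proof (cases "x = y")
  case False
  have "- (x powr s * gap x) \<le> - (y powr s * gap y)"
  proof (rule DERIV_nonneg_imp_increasing_open[of x y])
    fix z assume z: "x < z" "z < y"
    then have "0 \<le> z powr s * (z\<^sup>2 * (2 * tilted_mean z - 1) * tilted_var z) / z"
      using tilted_mean_mono[of x z] tilted_var_pos[of z] that by simp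
    then show "\<exists>w. ((\<lambda>x. - (x powr s * gap x)) has_real_derivative w) (at z) \<and> 0 \<le> w"
      using DERIV_minus[OF DERIV_scaled_gap[of z]] z \<open>0 \<le> x\<close>
      by (intro exI[of _ "- (z powr s * (z\<^sup>2 * (1 - 2 * tilted_mean z) * tilted_var z) / z)"])
         (simp add: algebra_simps diff_divide_distrib)
  qed (use that False in \<open>simp_all add: continuous_on_minus continuous_on_scaled_gap\<close>)
  then show ?thesis by simp
qed simp

section \<open>Ratio of two Kummer functions at a stationary point\<close>

text \<open>The hypothesis says that cgf x / x^2 is stationary at l. Then x excess - 2 cgf, whose
  derivative is \<open>gap\<close>, vanishes at 0 and at l, and Rolle's theorem gives a zero m of
  \<open>gap\<close>. Since \<open>gap\<close> is positive as long as the mean is at most 1/2, m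
  lies on the falling branch of x^s gap, which fixes the signs on both sides.\<close>

lemma balance_point:
  assumes "0 < l" "2 * cgf l = l * excess l"
  obtains m where "0 < m" "m < l" "gap m = 0" "1/2 < tilted_mean m"
    "\<And>x. 0 < x \<Longrightarrow> x \<le> m \<Longrightarrow> 0 \<le> gap x" "\<And>x. m \<le> x \<Longrightarrow> gap x \<le> 0"
proof -
  let ?G = "\<lambda>x. x * excess x - 2 * cgf x"
  have G: "(?G has_real_derivative gap x) (at x)" if "0 \<le> x" for x
    unfolding gap_def using that
    by (intro DERIV_cong[OF DERIV_diff[OF DERIV_mult[OF DERIV_ident DERIV_excess]
          DERIV_cmult[OF DERIV_cgf]]]) auto
  obtain m where m: "0 < m" "m < l" "(?G has_real_derivative 0) (at m)"
  proof (rule Rolle[of 0 l ?G, THEN exE])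
    show "?G 0 = ?G l" using assms by (simp add: cgf_0)
    show "continuous_on {0..l} ?G"
      by (auto intro!: continuous_at_imp_continuous_on DERIV_isCont[OF G])
    show "?G differentiable at x" if "0 < x" for x
      using G[of x] that by (auto simp: real_differentiable_def)
  qed (use assms in auto)
  have gap: "gap m = 0" using DERIV_unique[OF G[of m] m(3)] m(1) by simp
  have half: "1/2 < tilted_mean m" using gap_pos[of m] gap m(1) by force
  have "0 \<le> gap x" if "0 < x" "x \<le> m" for x
  proof (cases "tilted_mean x \<le> 1/2")
    case True
    then show ?thesis using gap_pos[of x] that by simp
  next
    case False
    then show ?thesis using scaled_gap_antimono[of x m] that gap by (simp add: zero_le_mult_iff)
  qed
  moreover have "gap x \<le> 0" if "m \<le> x" for x
    using scaled_gap_antimono[of m x] that gap half m(1) by (simp add: mult_le_0_iff)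
  ultimately show ?thesis using that m gap half by blast
qed

text \<open>If the mean at x is below 1/2, the drift at x is nonpositive and that at y nonnegative;
  otherwise both factors of the drift are nonnegative and monotone.\<close>

lemma drift_mono:
  assumes "0 \<le> x" "x \<le> y" "1/2 \<le> tilted_mean y"
  shows "drift x \<le> drift y"
proof (cases "1/2 \<le> tilted_mean x")
  case True
  then show ?thesis
    unfolding drift_def using tilted_mean_mono[of x y] assms by (intro mult_mono) auto
next
  case False
  then have "drift x \<le> 0" unfolding drift_def using assms by (simp add: mult_nonneg_nonpos)
  also have "0 \<le> drift y" unfolding drift_def using assms by simp
  finally show ?thesis .
qed

text \<open>Since \<open>weight\<close> tends to 0 at 0, the antiderivative is taken on the open
  half-line and normalised at l.\<close>

lemma resistance_exists:
  obtains W where "W l = 0" "\<And>x. 0 < x \<Longrightarrow> (W has_real_derivative - 1 / weight x) (at x)"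
proof -
  have "\<exists>F. \<forall>x::real. ereal 0 < ereal x \<longrightarrow> ereal x < \<infinity> \<longrightarrow>
      (F has_vector_derivative - 1 / weight x) (at x)"
  proof (rule einterval_antiderivative)
    show "isCont (\<lambda>x. - 1 / weight x) x" if "ereal 0 < ereal x" for x
      using that weight_pos[of x] DERIV_isCont[OF DERIV_weight[of x]]
      by (intro continuous_intros) auto
  qed simp
  then obtain F :: "real \<Rightarrow> real" where
    F: "\<And>x. 0 < x \<Longrightarrow> (F has_real_derivative - 1 / weight x) (at x)"
    by (auto simp: has_real_derivative_iff_has_vector_derivative)
  show ?thesis
  proof (rule that[of "\<lambda>x. F x - F l"])
    show "((\<lambda>x. F x - F l) has_real_derivative - 1 / weight x) (at x)" if "0 < x" for x
      using DERIV_diff[OF F[OF that] DERIV_const] by simp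
  qed simp
qed

end

text \<open>\<open>W x\<close> is the integral of \<open>1 / weight\<close> from \<open>x\<close> to \<open>l\<close>, so that \<open>U = weight * W\<close>
  solves \<open>x U' = (s + drift) U - x\<close> with \<open>U l = 0\<close>.\<close>

locale kummer_resistance = kummer_params +
  fixes l :: real and W :: "real \<Rightarrow> real"
  assumes l_pos: "0 < l" and W_end: "W l = 0"
    and DERIV_W: "\<And>x. 0 < x \<Longrightarrow> (W has_real_derivative - 1 / weight x) (at x)"
begin

lemma W_antimono: "W y \<le> W x" if "0 < x" "x \<le> y"
proof (rule DERIV_nonpos_imp_nonincreasing[OF that(2)])
  show "\<exists>w. (W has_real_derivative w) (at z) \<and> w \<le> 0" if "x \<le> z" for z
    using DERIV_W[of z] weight_pos[of z] that \<open>0 < x\<close>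
    by (intro exI[of _ "- 1 / weight z"]) auto
qed

lemma W_nonneg: "0 \<le> W x" if "0 < x" "x \<le> l"
  using W_antimono[OF that] W_end by simp

lemma W_pos: "0 < W x" if "0 < x" "x < l"
proof -
  have "W l < W x"
  proof (rule DERIV_neg_imp_decreasing[OF that(2)])
    show "\<exists>w. (W has_real_derivative w) (at z) \<and> w < 0" if "x \<le> z" for z
      using DERIV_W[of z] weight_pos[of z] that \<open>0 < x\<close>
      by (intro exI[of _ "- 1 / weight z"]) auto
  qed
  then show ?thesis by (simp add: W_end)
qed

text \<open>\<open>W\<close> itself may blow up at 0. But \<open>weight\<close> is nondecreasing on
  (0, s], so weight x times the integral of 1 / weight over [x, m] is at most m - x, and the
  remaining part weight x * W m tends to 0.\<close>

lemma weight_W_tendsto_0: "((\<lambda>x. weight x * W x) \<longlongrightarrow> 0) (at_right 0)"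
proof (rule tendstoI)
  fix e :: real assume "0 < e"
  \<comment> \<open>The bound e / 2 controls the length of [x, m], the bound s makes
    \<open>weight\<close> monotone there, and the bound l keeps \<open>W\<close>
    nonnegative.\<close>
  define m where "m = min (e / 2) (min l s)"
  have m: "0 < m" "m \<le> e / 2" "m \<le> l" "m \<le> s" using \<open>0 < e\<close> l_pos s_pos by (auto simp: m_def)
  have bound: "weight x * W x \<le> m + weight x * W m" if x: "0 < x" "x < m" for x
  proof -
    have "\<exists>z>x. z < m \<and> W m - W x = (m - x) * (- 1 / weight z)"
    proof (rule MVT2)
      show "(W has_real_derivative - 1 / weight t) (at t)" if "x \<le> t" for t
        using DERIV_W[of t] that x by simp
    qed (use x in simp)
    then obtain z where z: "x < z" "z < m" "W m - W x = (m - x) * (- 1 / weight z)" by blast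
    have "weight x \<le> weight z"
    proof (rule DERIV_nonneg_imp_nondecreasing[of x z weight])
      fix t assume t: "x \<le> t" "t \<le> z"
      have "- t \<le> drift t"
        using t x tilted_mean_pos[of t] by (simp add: drift_def algebra_simps)
      then have "0 \<le> weight t * (s + drift t) / t"
        using t x z m weight_pos[of t] by (intro divide_nonneg_nonneg mult_nonneg_nonneg) auto
      then show "\<exists>w. (weight has_real_derivative w) (at t) \<and> 0 \<le> w"
        using DERIV_weight[of t] t x by auto
    qed (use z in simp)
    then have "weight x * (m - x) \<le> (m - x) * weight z"
      using x mult_right_mono[of "weight x" "weight z" "m - x"] by (simp add: mult.commute)
    then have "weight x * (m - x) / weight z \<le> m - x"
      using weight_pos[of z] x z by (simp add: divide_le_eq)
    moreover have "W x = W m + (m - x) / weight z" using z(3) by simp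
    then have "weight x * W x = weight x * W m + weight x * (m - x) / weight z"
      by (simp add: distrib_left)
    ultimately show ?thesis using x by linarith
  qed
  have "(weight \<longlongrightarrow> weight 0) (at_right 0)"
    by (rule tendsto_within_subset[of weight _ 0 "{0..}"])
       (use continuous_on_weight in \<open>auto simp: continuous_on_def\<close>)
  then have "((\<lambda>x. weight x * W m) \<longlongrightarrow> 0 * W m) (at_right 0)"
    by (intro tendsto_mult tendsto_const) (simp add: weight_0)
  from order_tendstoD(2)[OF this, of "e / 2"]
  have "eventually (\<lambda>x. weight x * W m < e / 2) (at_right 0)"
    using \<open>0 < e\<close> by simp
  moreover have "eventually (\<lambda>x. x \<in> {0<..<m}) (at_right 0)"
    using eventually_at_right_real[OF m(1)] .
  ultimately show "eventually (\<lambda>x. dist (weight x * W x) 0 < e) (at_right 0)"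
  proof eventually_elim
    case (elim x)
    have "0 \<le> weight x * W x" using elim weight_pos[of x] W_nonneg[of x] m by simp
    then show ?case using bound[of x] elim m by simp
  qed
qed

text \<open>The difference c x - c m has the sign of \<open>e\<close>, whose derivative (c m * V -
  1) / weight changes sign at most once, from minus to plus, because \<open>drift\<close> is
  monotone. Together with e m = 0 and e l < 0 this fixes the sign of \<open>e\<close> on both sides
  of m.\<close>

lemma weight_W_compare:
  assumes m: "0 < m" "m < l" "1/2 \<le> tilted_mean m"
  defines "c \<equiv> \<lambda>x. weight x * W x / x"
  shows "0 < x \<Longrightarrow> x \<le> m \<Longrightarrow> c m \<le> c x" and "m \<le> x \<Longrightarrow> x \<le> l \<Longrightarrow> c x \<le> c m"
proof -
  \<comment> \<open>This is (c x - c m) * x / weight x; dividing \<open>weight\<close> out of c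
    leaves \<open>W\<close>, whose derivative is explicit.\<close>
  define e where "e x = W x - c m * (x / weight x)" for x
  define V where "V x = s - 1 + drift x" for x
  have cm: "0 < c m" using W_pos[of m] weight_pos[of m] m by (simp add: c_def)
  have e_deriv: "(e has_real_derivative (c m * V x - 1) / weight x) (at x)" if "0 < x" for x
  proof -
    have "(e has_real_derivative - 1 / weight x - c m *
        ((1 * weight x - x * (weight x * (s + drift x) / x)) / (weight x * weight x))) (at x)"
      unfolding e_def[abs_def] using that weight_pos[of x]
      by (intro DERIV_diff DERIV_W DERIV_cmult DERIV_divide DERIV_ident DERIV_weight) auto
    also have "- 1 / weight x - c m *
        ((1 * weight x - x * (weight x * (s + drift x) / x)) / (weight x * weight x)) =
        (c m * V x - 1) / weight x"
      using that weight_pos[of x] by (simp add: V_def field_simps)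
    finally show ?thesis .
  qed
  have e_m: "e m = 0" using weight_pos[of m] m by (simp add: e_def c_def)
  have e_l: "e l < 0" using weight_pos[of l] l_pos cm by (simp add: e_def W_end)
  have up: "e x \<le> e y" if "0 < x" "x \<le> y" "\<And>z. x \<le> z \<Longrightarrow> z \<le> y \<Longrightarrow> 1 \<le> c m * V z" for x y
  proof (rule DERIV_nonneg_imp_nondecreasing[OF that(2), of e])
    fix z assume z: "x \<le> z" "z \<le> y"
    then have "0 \<le> (c m * V z - 1) / weight z"
      using that(1) that(3)[OF z] weight_pos[of z] by simp
    then show "\<exists>w. (e has_real_derivative w) (at z) \<and> 0 \<le> w"
      using e_deriv[of z] z that(1) by auto
  qed
  have down: "e y \<le> e x" if "0 < x" "x \<le> y" "\<And>z. x \<le> z \<Longrightarrow> z \<le> y \<Longrightarrow> c m * V z \<le> 1" for x y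
  proof (rule DERIV_nonpos_imp_nonincreasing[OF that(2), of e])
    fix z assume z: "x \<le> z" "z \<le> y"
    then have "(c m * V z - 1) / weight z \<le> 0"
      using that(1) that(3)[OF z] weight_pos[of z] by (simp add: divide_nonpos_pos)
    then show "\<exists>w. (e has_real_derivative w) (at z) \<and> w \<le> 0"
      using e_deriv[of z] z that(1) by auto
  qed
  have V_mono: "c m * V x \<le> c m * V y" if "0 \<le> x" "x \<le> y" "m \<le> y" for x y
    using drift_mono[of x y] tilted_mean_mono[of m y] that m cm by (simp add: V_def)
  \<comment> \<open>Otherwise \<open>e\<close> would be nondecreasing on [m, l], against e m = 0 and
    e l < 0.\<close>
  have V_m: "c m * V m \<le> 1"
  proof (rule ccontr)
    assume "\<not> c m * V m \<le> 1"
    then have "1 \<le> c m * V z" if "m \<le> z" for z using V_mono[of m z] m that by simp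
    then have "e m \<le> e l" using m by (intro up) auto
    then show False using e_m e_l by simp
  qed
  have sign: "0 \<le> e x \<longleftrightarrow> c m \<le> c x" "e x \<le> 0 \<longleftrightarrow> c x \<le> c m" if "0 < x" for x
  proof -
    define k w where "k = c m" and "w = weight x / x"
    have w: "0 < w" using that weight_pos[of x] by (simp add: w_def)
    have "c x = k + w * e x"
      using that weight_pos[of x] unfolding e_def k_def[symmetric] w_def
      by (simp add: c_def right_diff_distrib)
    then show "0 \<le> e x \<longleftrightarrow> c m \<le> c x" "e x \<le> 0 \<longleftrightarrow> c x \<le> c m"
      using w unfolding k_def[symmetric] by (simp_all add: zero_le_mult_iff mult_le_0_iff)
  qed
  show "c m \<le> c x" if x: "0 < x" "x \<le> m"
  proof -
    have "e m \<le> e x"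
    proof (rule down)
      show "c m * V z \<le> 1" if "x \<le> z" "z \<le> m" for z
        using V_mono[of z m] V_m that x m by simp
    qed (use x in auto)
    then show ?thesis using sign(1)[of x] e_m x by simp
  qed
  show "c x \<le> c m" if x: "m \<le> x" "x \<le> l"
  proof -
    have "e x \<le> 0"
    \<comment> \<open>On [m, l] the function \<open>e\<close> first falls from 0 and then rises to e
      l < 0; the two cases are these two phases.\<close>
    proof (cases "c m * V x \<le> 1")
      case True
      have "e x \<le> e m"
      proof (rule down)
        show "c m * V z \<le> 1" if "m \<le> z" "z \<le> x" for z
          using V_mono[of z x] True that m by simp
      qed (use x m in auto)
      then show ?thesis by (simp add: e_m)
    next
      case False
      have "e x \<le> e l"
      proof (rule up)
        show "1 \<le> c m * V z" if "x \<le> z" "z \<le> l" for z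
          using V_mono[of x z] False that x m by simp
      qed (use x m in auto)
      then show ?thesis using e_l by simp
    qed
    then show ?thesis using sign(2)[of x] x m by simp
  qed
qed

end

lemma kummer_mono_param:
  assumes "0 < a" "a \<le> b" "b < s" "0 \<le> x"
  shows "kummer a s x \<le> kummer b s x"
proof -
  interpret a: kummer_params a s using assms by unfold_locales auto
  interpret b: kummer_params b s using assms by unfold_locales auto
  have "kummer_coeff a s n \<le> kummer_coeff b s n" for n
    using pochhammer_mono_real[of a b n] pochhammer_pos[of s n] assms
    by (simp add: kummer_coeff_def divide_right_mono)
  then show ?thesis
    unfolding kummer_def using assms
    by (intro suminf_le a.summable_kummer b.summable_kummer mult_right_mono) auto
qed

context kummer_params
begin

text \<open>This is d ln excess / d ln x. Since gap = excess * (log_slope - 1), the sign of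
  \<open>gap\<close> is read off by comparison with 1.\<close>

definition log_slope :: "real \<Rightarrow> real" where
  "log_slope x = x * tilted_var x / excess x"

lemma excess_ratio_tendsto: "((\<lambda>x. excess x / x) \<longlongrightarrow> tilted_var 0) (at_right 0)"
proof -
  have "((\<lambda>x. (excess (0 + x) - excess 0) / x) \<longlongrightarrow> tilted_var 0) (at 0)"
    using DERIV_excess[of 0] by (simp add: DERIV_def)
  then show ?thesis by (simp add: excess_0 filterlim_at_split)
qed

lemma log_slope_tendsto_1: "(log_slope \<longlongrightarrow> 1) (at_right 0)"
proof -
  have "(tilted_var \<longlongrightarrow> tilted_var 0) (at_right 0)"
    using isCont_tilted_var[of 0] by (simp add: isCont_def filterlim_at_split)
  moreover have nz: "tilted_var 0 \<noteq> 0"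
    using a_pos a_less by (simp add: tilted_var_0)
  ultimately have "((\<lambda>x. tilted_var x / (excess x / x)) \<longlongrightarrow> tilted_var 0 / tilted_var 0) (at_right 0)"
    by (intro tendsto_divide excess_ratio_tendsto)
  then show ?thesis
    using nz by (simp add: log_slope_def[abs_def] mult.commute)
qed

text \<open>The linear equation for \<open>tilted_var\<close> becomes a Riccati equation for the
  quotient by \<open>excess\<close>; its quadratic term later lets the derivative of
  \<open>\<Phi>\<close> factor.\<close>

lemma DERIV_weight_log_slope:
  "((\<lambda>x. weight x * log_slope x) has_real_derivative
    weight x * (log_slope x + s - (log_slope x)\<^sup>2) / x) (at x)" if "0 < x"
proof (rule DERIV_weight_times[OF that])
  define D' where "D' = (s * excess x / x - (s + drift x) * tilted_var x) / x"
  let ?n' = "((1 * tilted_var x + D' * x) * excess x - (x * tilted_var x) * tilted_var x)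
      / (excess x * excess x)"
  have e: "excess x \<noteq> 0" using excess_pos[OF that] by simp
  show "(log_slope has_real_derivative ?n') (at x)"
    unfolding log_slope_def[abs_def] D'_def using that e
    by (intro DERIV_divide DERIV_mult DERIV_ident DERIV_tilted_var DERIV_excess) auto
  have D': "x * (D' * x) = s * excess x - (s + drift x) * (x * tilted_var x)"
    using that by (simp add: D'_def right_diff_distrib)
  have "x * ((1 * tilted_var x + D' * x) * excess x - (x * tilted_var x) * tilted_var x) =
      (x * tilted_var x + x * (D' * x)) * excess x - (x * tilted_var x)\<^sup>2"
    by (simp add: algebra_simps power2_eq_square)
  also have "\<dots> = (x * tilted_var x + s * excess x - (s + drift x) * (x * tilted_var x)) * excess x -
      (x * tilted_var x)\<^sup>2"
    unfolding D' by (simp only: add_diff_eq)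
  finally have "x * ?n' = ((x * tilted_var x + s * excess x - (s + drift x) * (x * tilted_var x)) * excess x -
      (x * tilted_var x)\<^sup>2) / (excess x * excess x)" by simp
  also have "\<dots> = log_slope x + s - (s + drift x) * log_slope x - (log_slope x)\<^sup>2"
    using e by (simp add: log_slope_def divide_simps power2_eq_square)
  finally show "x * ?n' + (s + drift x) * log_slope x = log_slope x + s - (log_slope x)\<^sup>2"
    by simp
qed

text \<open>The ratio \<open>R\<close> of the two Kummer functions satisfies \<open>(weight R')' = s h weight R / x\<close>.
  The auxiliary function \<open>\<Phi>\<close> has a lower bound tending to \<open>0\<close> at \<open>0\<close>, equals
  \<open>(R l - 1) / h - l\<close> at \<open>l\<close> because of \<open>W l = 0\<close> and the stationarity of \<open>l\<close>, and is
  nondecreasing: its derivative is a product of two factors that both change sign at the balance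
  point \<open>m\<close> (this fixes the multiplier \<open>\<omega>\<close>) plus a nonnegative term.\<close>

lemma kummer_ratio_ge:
  assumes l: "0 < l" "2 * cgf l = l * excess l" and h: "0 < h" "a + s * h < s"
  shows "1 + h * l \<le> kummer (a + s * h) s l / kummer a s l"
proof -
  define b where "b = a + s * h"
  interpret b: kummer_params b s
    unfolding b_def using a_pos s_pos h by unfold_locales (auto intro: add_pos_pos)
  obtain W where W: "W l = 0" "\<And>x. 0 < x \<Longrightarrow> (W has_real_derivative - 1 / weight x) (at x)"
    using resistance_exists[of l] by blast
  interpret kummer_resistance a s l W
    using l W by unfold_locales auto
  obtain m where m: "0 < m" "m < l" "gap m = 0" "1/2 < tilted_mean m"
    "\<And>x. 0 < x \<Longrightarrow> x \<le> m \<Longrightarrow> 0 \<le> gap x" "\<And>x. m \<le> x \<Longrightarrow> gap x \<le> 0"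
    using balance_point[OF l] by blast
  define c where "c x = weight x * W x / x" for x
  define n where "n = log_slope"
  define R where "R x = kummer b s x / kummer a s x" for x
  \<comment> \<open>\<open>P\<close> is weight * R' / h, a multiple of the Wronskian of the two
    Kummer functions; in this form it is visibly continuous and zero at 0.\<close>
  define P where "P x = x powr s * (exp (- x) * (kummer_deriv b s x * kummer a s x -
      kummer b s x * kummer_deriv a s x) / h)" for x
  define \<omega> where "\<omega> = (1 + c m) / excess m"
  define G where "G x = x * excess x - 2 * cgf x" for x
  define \<Phi> where "\<Phi> x = (R x - 1) / h - x + W x * (P x - weight x * n x) - \<omega> * G x" for x

  have R_ge: "1 \<le> R x" if "0 \<le> x" for x
    using kummer_mono_param[of a b s x] a_pos s_pos h that kummer_pos[OF that]
    by (simp add: R_def b_def le_divide_eq_1_pos)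
  have R_deriv: "(R has_real_derivative h * P x / weight x) (at x)" if "0 < x" for x
  proof -
    have "(R has_real_derivative (kummer_deriv b s x * kummer a s x -
        kummer b s x * kummer_deriv a s x) / (kummer a s x * kummer a s x)) (at x)"
      unfolding R_def[abs_def] using kummer_pos[of x] that
      by (intro DERIV_divide DERIV_kummer b.DERIV_kummer) auto
    also have "(kummer_deriv b s x * kummer a s x -
        kummer b s x * kummer_deriv a s x) / (kummer a s x * kummer a s x) = h * P x / weight x"
      using that h by (simp add: P_def weight_def power2_eq_square)
    finally show ?thesis .
  qed
  have P_deriv: "(P has_real_derivative weight x * (s * R x) / x) (at x)" if "0 < x" for x
  proof -
    let ?A = "kummer a s x" and ?A1 = "kummer_deriv a s x" and ?A2 = "kummer_deriv2 a s x"
    let ?B = "kummer b s x" and ?B1 = "kummer_deriv b s x" and ?B2 = "kummer_deriv2 b s x"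
    let ?g = "\<lambda>x. exp (- x) * (kummer_deriv b s x * kummer a s x -
      kummer b s x * kummer_deriv a s x) / h"
    let ?g' = "exp (- x) * (?B2 * ?A - ?B * ?A2 - (?B1 * ?A - ?B * ?A1)) / h"
    have "(?g has_real_derivative ?g') (at x)"
      using h by (auto intro!: derivative_eq_intros DERIV_kummer DERIV_kummer_deriv
          b.DERIV_kummer b.DERIV_kummer_deriv simp: field_simps)
    \<comment> \<open>Both Kummer equations share the parameter s, so after substitution only the
      difference b - a = s * h of the right-hand sides survives.\<close>
    moreover have "x * ?g' + s * ?g x = exp (- x) * s * ?A * ?B"
    proof -
      have "x * ?g' + s * ?g x = exp (- x) * ((x * ?B2 + (s - x) * ?B1) * ?A -
          ?B * (x * ?A2 + (s - x) * ?A1)) / h"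
        using h by (simp add: field_simps)
      also have "\<dots> = exp (- x) * s * ?A * ?B"
        unfolding kummer_ode b.kummer_ode using h by (simp add: b_def field_simps)
      finally show ?thesis .
    qed
    ultimately have "(P has_real_derivative x powr s * (exp (- x) * s * ?A * ?B) / x) (at x)"
      unfolding P_def[abs_def] by (rule DERIV_powr_times[OF that])
    then show ?thesis
      using kummer_pos[of x] that by (simp add: R_def weight_def power2_eq_square mult_ac)
  qed
  have P_nonneg: "0 \<le> P x" if "0 < x" for x
  proof -
    have "P 0 \<le> P x"
    proof (rule DERIV_nonneg_imp_increasing_open[of 0 x P])
      fix y :: real assume "0 < y"
      then have "0 \<le> weight y * (s * R y) / y"
        using weight_pos[of y] R_ge[of y] s_pos by simp
      then show "\<exists>z. (P has_real_derivative z) (at y) \<and> 0 \<le> z"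
        using P_deriv[OF \<open>0 < y\<close>] by blast
    next
      show "continuous_on {0..x} P"
        unfolding P_def[abs_def] using h
        by (intro continuous_intros continuous_on_subset[OF continuous_on_powr_nonneg]
            continuous_at_imp_continuous_on ballI DERIV_isCont[OF DERIV_kummer]
            DERIV_isCont[OF DERIV_kummer_deriv] DERIV_isCont[OF b.DERIV_kummer]
            DERIV_isCont[OF b.DERIV_kummer_deriv]) auto
    qed (use that in simp)
    then show ?thesis by (simp add: P_def)
  qed
  have G_deriv: "(G has_real_derivative gap x) (at x)" if "0 \<le> x" for x
    unfolding G_def[abs_def] gap_def using that
    by (intro DERIV_cong[OF DERIV_diff[OF DERIV_mult[OF DERIV_ident DERIV_excess]
          DERIV_cmult[OF DERIV_cgf]]]) auto
  have gap_n: "gap x = excess x * (n x - 1)" if "0 < x" for x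
    using excess_pos[OF that] by (simp add: gap_def n_def log_slope_def right_diff_distrib)
  have \<Phi>_deriv: "(\<Phi> has_real_derivative
      (n x - 1) * (1 + c x * n x - \<omega> * excess x) + c x * (s * (R x - 1))) (at x)"
    if "0 < x" for x
  proof -
    have w: "weight x \<noteq> 0" using weight_pos[OF that] by simp
    have "(\<Phi> has_real_derivative (h * P x / weight x - 0) / h - 1 +
        (- 1 / weight x * (P x - weight x * n x) +
          (weight x * (s * R x) / x - weight x * (n x + s - (n x)\<^sup>2) / x) * W x) -
        \<omega> * gap x) (at x)"
      unfolding \<Phi>_def[abs_def] using that n_def
      by (intro DERIV_diff DERIV_add DERIV_cdivide DERIV_mult DERIV_cmult DERIV_ident DERIV_const
          R_deriv P_deriv W(2) G_deriv DERIV_weight_log_slope[folded n_def]) auto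
    also have "(h * P x / weight x - 0) / h - 1 +
        (- 1 / weight x * (P x - weight x * n x) +
          (weight x * (s * R x) / x - weight x * (n x + s - (n x)\<^sup>2) / x) * W x) - \<omega> * gap x
      = n x - 1 + c x * (s * R x - (n x + s - (n x)\<^sup>2)) - \<omega> * gap x"
      using w h that by (simp add: c_def field_simps)
    \<comment> \<open>The Riccati terms n^2 - n and gap = excess * (n - 1) share the factor n - 1;
      what remains is the multiple of R - 1.\<close>
    also have "\<dots> = (n x - 1) * (1 + c x * n x - \<omega> * excess x) + c x * (s * (R x - 1))"
      unfolding gap_n[OF that] by (simp add: algebra_simps power2_eq_square)
    finally show ?thesis .
  qed
  have exm: "0 < excess m" using excess_pos m by simp
  have cm: "0 \<le> c m" using W_nonneg[of m] weight_pos[of m] m by (simp add: c_def)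
  have \<omega>_m: "1 + c m = \<omega> * excess m" using exm by (simp add: \<omega>_def)
  have \<omega>_pos: "0 \<le> \<omega>" using exm cm by (simp add: \<omega>_def)
  have excess_mono: "excess x \<le> excess y" if "0 \<le> x" "x \<le> y" for x y
    using tilted_mean_mono[OF that] by (simp add: excess_def)
  have n_nonneg: "0 \<le> n x" if "0 < x" for x
    using that excess_pos[OF that] tilted_var_pos[OF that] by (simp add: n_def log_slope_def)
  have c_nonneg: "0 \<le> c x" if "0 < x" "x \<le> l" for x
    using W_nonneg[OF that] weight_pos[of x] that by (simp add: c_def)
  have slope: "0 \<le> (n x - 1) * (1 + c x * n x - \<omega> * excess x) + c x * (s * (R x - 1))"
    if x: "0 < x" "x \<le> l" for x
  proof -
    \<comment> \<open>Left of m both factors are nonnegative, right of m both are nonpositive: n - 1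
      by the sign of \<open>gap\<close>, the other one by monotonicity of \<open>excess\<close> and
      the comparison of c x with c m.\<close>
    have "0 \<le> (n x - 1) * (1 + c x * n x - \<omega> * excess x)"
    proof (cases "x \<le> m")
      case True
      have n1: "1 \<le> n x"
        using m(5)[of x] True x gap_n[of x] excess_pos[of x] by (simp add: zero_le_mult_iff)
      have "\<omega> * excess x \<le> \<omega> * excess m"
        using excess_mono[of x m] True x \<omega>_pos by (intro mult_left_mono) auto
      also have "\<dots> = 1 + c m" by (simp add: \<omega>_m)
      also have "c m \<le> c x"
        using weight_W_compare(1)[of m x] True x m by (simp add: c_def)
      also have "c x \<le> c x * n x"
        using n1 c_nonneg[OF x] mult_left_mono[of 1 "n x" "c x"] by simp
      finally show ?thesis using n1 by simp
    next
      case False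
      have n1: "n x \<le> 1"
        using m(6)[of x] False x gap_n[of x] excess_pos[of x] by (simp add: mult_le_0_iff)
      have "1 + c x * n x \<le> 1 + c x"
        using n1 c_nonneg[OF x] mult_left_mono[of "n x" 1 "c x"] by simp
      also have "c x \<le> c m"
        using weight_W_compare(2)[of m x] False x m by (simp add: c_def)
      also have "1 + c m = \<omega> * excess m" by (simp add: \<omega>_m)
      also have "\<dots> \<le> \<omega> * excess x"
        using excess_mono[of m x] False m \<omega>_pos by (intro mult_left_mono) auto
      finally show ?thesis using n1 by (simp add: mult_nonpos_nonpos)
    qed
    moreover have "0 \<le> c x * (s * (R x - 1))"
      using c_nonneg[OF x] R_ge[of x] s_pos x by simp
    ultimately show ?thesis by simp
  qed
  have mono: "\<Phi> x \<le> \<Phi> l" if x: "0 < x" "x \<le> l" for x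
  proof (rule DERIV_nonneg_imp_nondecreasing[OF x(2), of \<Phi>])
    fix y assume "x \<le> y" "y \<le> l"
    then show "\<exists>z. (\<Phi> has_real_derivative z) (at y) \<and> 0 \<le> z"
      using \<Phi>_deriv[of y] slope[of y] x by auto
  qed
  \<comment> \<open>This is \<open>\<Phi>\<close> without the nonnegative term W * P, so near 0 only
    the product weight * W needs a limit.\<close>
  let ?low = "\<lambda>x. (R x - 1) / h - x - weight x * W x * n x - \<omega> * G x"
  have "0 \<le> \<Phi> l"
  proof (rule tendsto_upperbound)
    show "at_right 0 \<noteq> (bot :: real filter)" by simp
    have "(R \<longlongrightarrow> R 0) (at_right 0)"
    proof -
      have "isCont R 0" unfolding R_def[abs_def] using kummer_pos[of 0]
        by (intro isCont_divide DERIV_isCont[OF DERIV_kummer] DERIV_isCont[OF b.DERIV_kummer]) simp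
      then show ?thesis by (simp add: isCont_def filterlim_at_split)
    qed
    moreover have "(G \<longlongrightarrow> G 0) (at_right 0)"
      using DERIV_isCont[OF G_deriv[of 0]] by (simp add: isCont_def filterlim_at_split)
    ultimately have "(?low \<longlongrightarrow> (R 0 - 1) / h - 0 - 0 * 1 - \<omega> * G 0) (at_right 0)"
      using h log_slope_tendsto_1
      by (intro tendsto_intros weight_W_tendsto_0) (auto simp: n_def)
    then show "(?low \<longlongrightarrow> 0) (at_right 0)"
      by (simp add: R_def G_def kummer_0 b.kummer_0 cgf_0)
    have "eventually (\<lambda>x. x \<in> {0<..<l}) (at_right 0)"
      using eventually_at_right_real[OF l(1)] .
    then show "eventually (\<lambda>x. ?low x \<le> \<Phi> l) (at_right 0)"
    proof eventually_elim
      case (elim x)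
      have "0 \<le> W x * P x" using elim W_nonneg[of x] P_nonneg[of x] by simp
      then have "?low x \<le> \<Phi> x" by (simp add: \<Phi>_def right_diff_distrib mult_ac)
      also have "\<Phi> x \<le> \<Phi> l" using mono[of x] elim by simp
      finally show ?case .
    qed
  qed
  then have "0 \<le> (R l - 1) / h - l"
    using l by (simp add: \<Phi>_def W(1) G_def)
  then have "l \<le> (R l - 1) / h" by simp
  then have "l * h \<le> R l - 1" using h by (simp add: le_divide_eq)
  then show ?thesis by (simp add: R_def b_def mult.commute)
qed

end

section \<open>Monotonicity in the first parameter\<close>

text \<open>The sub-Gaussian bound on the positive half-line for a variable with moment generating
  function 1F1(a; s; .) and mean a / s; \<open>v\<close> is the proxy variance.\<close>

definition kummer_dominated :: "real \<Rightarrow> real \<Rightarrow> real \<Rightarrow> bool" where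
  "kummer_dominated a s v \<longleftrightarrow> (\<forall>x>0. kummer a s x \<le> exp (a / s * x + v * x\<^sup>2 / 2))"

lemma ln_add_one_ge_quadratic: "x - x\<^sup>2 / 2 \<le> ln (1 + x)" if "0 \<le> x" for x :: real
proof -
  have "ln (1 + 0) - (0 - 0\<^sup>2 / 2) \<le> ln (1 + x) - (x - x\<^sup>2 / 2)"
  proof (rule DERIV_nonneg_imp_nondecreasing[OF that, of "\<lambda>x. ln (1 + x) - (x - x\<^sup>2 / 2)"])
    fix y :: real assume "0 \<le> y"
    then have "((\<lambda>x. ln (1 + x) - (x - x\<^sup>2 / 2)) has_real_derivative 1 / (1 + y) - (1 - y)) (at y)"
      by (auto intro!: derivative_eq_intros)
    moreover have "0 \<le> 1 / (1 + y) - (1 - y)"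
      using \<open>0 \<le> y\<close> by (simp add: field_simps)
    ultimately show "\<exists>d. ((\<lambda>x. ln (1 + x) - (x - x\<^sup>2 / 2)) has_real_derivative d) (at y) \<and> 0 \<le> d"
      by blast
  qed
  then show ?thesis by simp
qed

context kummer_params
begin

lemma kummer_dominated_iff:
  "kummer_dominated a s v \<longleftrightarrow> (\<forall>x>0. cgf x \<le> v * x\<^sup>2 / 2)"
proof -
  have "kummer a s x \<le> exp (a / s * x + v * x\<^sup>2 / 2) \<longleftrightarrow> cgf x \<le> v * x\<^sup>2 / 2" if "0 < x" for x
  proof -
    have "kummer a s x \<le> exp (a / s * x + v * x\<^sup>2 / 2) \<longleftrightarrow>
        ln (kummer a s x) \<le> a / s * x + v * x\<^sup>2 / 2"
      using kummer_pos[of x] that by (subst ln_le_cancel_iff[symmetric]) auto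
    then show ?thesis by (auto simp: cgf_def)
  qed
  then show ?thesis by (auto simp: kummer_dominated_def)
qed

lemma cgf_le_of_excess_le:
  assumes "0 \<le> x" "\<And>y. 0 \<le> y \<Longrightarrow> y \<le> x \<Longrightarrow> excess y \<le> v * y"
  shows "cgf x \<le> v * x\<^sup>2 / 2"
proof -
  have "v * 0\<^sup>2 / 2 - cgf 0 \<le> v * x\<^sup>2 / 2 - cgf x"
  proof (rule DERIV_nonneg_imp_nondecreasing[OF assms(1), of "\<lambda>x. v * x\<^sup>2 / 2 - cgf x"])
    fix y assume y: "0 \<le> y" "y \<le> x"
    have "((\<lambda>x. v * x\<^sup>2 / 2 - cgf x) has_real_derivative v * y - excess y) (at y)"
      using y by (auto intro!: derivative_eq_intros DERIV_cgf)
    then show "\<exists>d. ((\<lambda>x. v * x\<^sup>2 / 2 - cgf x) has_real_derivative d) (at y) \<and> 0 \<le> d"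
      using assms(2)[OF y] by (intro exI[of _ "v * y - excess y"]) simp
  qed
  then show ?thesis by (simp add: cgf_0)
qed

lemma cgf_ge_of_excess_ge:
  assumes "0 \<le> x" "\<And>y. 0 \<le> y \<Longrightarrow> y \<le> x \<Longrightarrow> v * y \<le> excess y"
  shows "v * x\<^sup>2 / 2 \<le> cgf x"
proof -
  have "cgf 0 - v * 0\<^sup>2 / 2 \<le> cgf x - v * x\<^sup>2 / 2"
  proof (rule DERIV_nonneg_imp_nondecreasing[OF assms(1), of "\<lambda>x. cgf x - v * x\<^sup>2 / 2"])
    fix y assume y: "0 \<le> y" "y \<le> x"
    have "((\<lambda>x. cgf x - v * x\<^sup>2 / 2) has_real_derivative excess y - v * y) (at y)"
      using y by (auto intro!: derivative_eq_intros DERIV_cgf)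
    then show "\<exists>d. ((\<lambda>x. cgf x - v * x\<^sup>2 / 2) has_real_derivative d) (at y) \<and> 0 \<le> d"
      using assms(2)[OF y] by (intro exI[of _ "excess y - v * y"]) simp
  qed
  then show ?thesis by (simp add: cgf_0)
qed

lemma cgf_le_near_0:
  assumes "tilted_var 0 < v"
  obtains d where "0 < d" "\<And>x. 0 < x \<Longrightarrow> x \<le> d \<Longrightarrow> cgf x \<le> v * x\<^sup>2 / 2"
proof -
  obtain e where e: "0 < e" "\<And>x. 0 < x \<Longrightarrow> x < e \<Longrightarrow> excess x / x < v"
    using order_tendstoD(2)[OF excess_ratio_tendsto assms]
    by (auto simp: eventually_at_right_field)
  show ?thesis
  proof (rule that[of "e / 2"])
    fix x assume x: "0 < x" "x \<le> e / 2"
    show "cgf x \<le> v * x\<^sup>2 / 2"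
    proof (rule cgf_le_of_excess_le)
      show "excess y \<le> v * y" if "0 \<le> y" "y \<le> x" for y
        using e(2)[of y] e(1) that x by (cases "y = 0") (auto simp: excess_0 field_simps)
    qed (use x in simp)
  qed (use e in simp)
qed

text \<open>As x tends to 0, excess x / x tends to \<open>tilted_var 0\<close>, the variance.
  Integrating excess y >= w * y with w strictly between v and the variance would violate the bound
  near 0.\<close>

lemma kummer_dominated_imp_var_le:
  assumes "kummer_dominated a s v"
  shows "tilted_var 0 \<le> v"
proof (rule ccontr)
  assume "\<not> tilted_var 0 \<le> v"
  then obtain w where w: "v < w" "w < tilted_var 0" using dense[of v "tilted_var 0"] by auto
  obtain e where e: "0 < e" "\<And>x. 0 < x \<Longrightarrow> x < e \<Longrightarrow> w < excess x / x"
    using order_tendstoD(1)[OF excess_ratio_tendsto w(2)]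
    by (auto simp: eventually_at_right_field)
  have "w * (e / 2)\<^sup>2 / 2 \<le> cgf (e / 2)"
  proof (rule cgf_ge_of_excess_ge)
    show "w * y \<le> excess y" if "0 \<le> y" "y \<le> e / 2" for y
      using e(2)[of y] e(1) that by (cases "y = 0") (auto simp: excess_0 field_simps)
  qed (use e in simp)
  also have "\<dots> \<le> v * (e / 2)\<^sup>2 / 2"
    using assms e(1) by (simp add: kummer_dominated_iff)
  finally show False using w(1) e(1) by simp
qed

text \<open>Here the mean is at least 1/2 from the start, so x^s gap falls from 0 and
  \<open>gap\<close> is nonpositive. Hence excess x / x is nonincreasing and bounded by its limit at
  0, the variance; integration gives the bound on \<open>cgf\<close>.\<close>

lemma kummer_dominated_of_half_le:
  assumes "1/2 \<le> a / s" "tilted_var 0 \<le> v"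
  shows "kummer_dominated a s v"
  unfolding kummer_dominated_iff
proof (intro allI impI)
  fix x :: real assume "0 < x"
  have gap_nonpos: "gap y \<le> 0" if "0 < y" for y
  proof -
    have "y powr s * gap y \<le> 0 powr s * gap 0"
      using scaled_gap_antimono[of 0 y] that assms(1) by (simp add: tilted_mean_0)
    then show ?thesis using that by (simp add: mult_le_0_iff)
  qed
  have ratio_le: "excess y / y \<le> excess z / z" if z: "0 < z" "z \<le> y" for y z
  proof (rule DERIV_nonpos_imp_nonincreasing[OF z(2), of "\<lambda>x. excess x / x"])
    fix t assume "z \<le> t"
    then have t: "0 < t" using z by simp
    have "((\<lambda>x. excess x / x) has_real_derivative gap t / t\<^sup>2) (at t)"
      using DERIV_divide[OF DERIV_excess DERIV_ident, of t] t
      by (simp add: gap_def power2_eq_square mult.commute)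
    moreover have "gap t / t\<^sup>2 \<le> 0" using gap_nonpos[OF t] by (simp add: divide_nonpos_nonneg)
    ultimately show "\<exists>d. ((\<lambda>x. excess x / x) has_real_derivative d) (at t) \<and> d \<le> 0" by blast
  qed
  show "cgf x \<le> v * x\<^sup>2 / 2"
  proof (rule cgf_le_of_excess_le)
    fix y :: real assume "0 \<le> y"
    show "excess y \<le> v * y"
    proof (cases "y = 0")
      case False
      then have y: "0 < y" using \<open>0 \<le> y\<close> by simp
      have "excess y / y \<le> tilted_var 0"
      proof (rule tendsto_lowerbound[OF excess_ratio_tendsto])
        show "eventually (\<lambda>z. excess y / y \<le> excess z / z) (at_right 0)"
          using eventually_at_right_real[OF y] by eventually_elim (use ratio_le in auto)
      qed simp
      then have "excess y / y \<le> v" using assms(2) by simp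
      then show ?thesis using y by (simp add: divide_le_eq)
    qed (simp add: excess_0)
  qed (use \<open>0 < x\<close> in simp)
qed

section \<open>Maximisers of 2 cgf x / x^2 and one step in the parameter\<close>

lemma cgf_le_linear: "cgf x \<le> x" if "0 \<le> x"
proof -
  have "0 - cgf 0 \<le> x - cgf x"
  proof (rule DERIV_nonneg_imp_nondecreasing[OF that, of "\<lambda>x. x - cgf x"])
    fix y :: real assume y: "0 \<le> y"
    have "excess y \<le> 1"
      using tilted_mean_less_1[OF y] divide_pos_pos[OF a_pos s_pos] by (simp add: excess_def)
    then show "\<exists>d. ((\<lambda>x. x - cgf x) has_real_derivative d) (at y) \<and> 0 \<le> d"
      using DERIV_diff[OF DERIV_ident DERIV_cgf[OF y]] by (intro exI[of _ "1 - excess y"]) simp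
  qed
  then show ?thesis by (simp add: cgf_0)
qed

text \<open>The ratio F is at most w near 0, where its limit is below w, and for large x, because
  \<open>cgf\<close> grows at most linearly. If it exceeds w somewhere, its maximum over a compact
  interval is attained at an interior point, and F' = 0 there is the stationarity relation.\<close>

lemma stationary_ratio_exists:
  assumes w: "tilted_var 0 < w" and x: "0 < x" "w * x\<^sup>2 / 2 < cgf x"
  obtains l where "0 < l" "2 * cgf l = l * excess l" "w * l\<^sup>2 / 2 < cgf l"
proof -
  define F where "F x = 2 * cgf x / x\<^sup>2" for x
  have F_iff: "w < F x \<longleftrightarrow> w * x\<^sup>2 / 2 < cgf x" if "0 < x" for x
    using that by (simp add: F_def less_divide_eq) linarith
  have w_pos: "0 < w"
  proof -
    have "0 < tilted_var 0" using a_pos a_less s_pos by (simp add: tilted_var_0)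
    then show ?thesis using w by simp
  qed
  obtain d where d: "0 < d" "\<And>x. 0 < x \<Longrightarrow> x \<le> d \<Longrightarrow> cgf x \<le> w * x\<^sup>2 / 2"
    using cgf_le_near_0[OF w] by blast
  \<comment> \<open>From 2 / w on one has y <= w * y^2 / 2, so the linear bound on
    \<open>cgf\<close> suffices.\<close>
  define L where "L = 2 / w"
  have far: "cgf y \<le> w * y\<^sup>2 / 2" if "L \<le> y" for y
  proof -
    have y: "2 \<le> w * y" "0 < y" using that w_pos less_le_trans[of 0 L y]
      by (auto simp: L_def divide_le_eq mult.commute)
    have "cgf y \<le> y" using cgf_le_linear[of y] y by simp
    also have "y * 2 \<le> y * (w * y)" using y by (intro mult_left_mono) auto
    then have "y \<le> w * y\<^sup>2 / 2" by (simp add: power2_eq_square mult_ac)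
    finally show ?thesis .
  qed
  have between: "d < y \<and> y < L" if "0 < y" "w < F y" for y
    using d(2)[of y] far[of y] F_iff[of y] that by force
  have dx: "d < x" "x < L" using between[of x] F_iff[of x] x by auto
  have F_deriv: "(F has_real_derivative (2 * excess y * y\<^sup>2 - 2 * cgf y * (2 * y)) / (y\<^sup>2 * y\<^sup>2)) (at y)"
    if "0 < y" for y
    unfolding F_def[abs_def] using that
    by (auto intro!: derivative_eq_intros DERIV_cgf)
  have "\<exists>l\<in>{d..L}. \<forall>y\<in>{d..L}. F y \<le> F l"
  proof (rule continuous_attains_sup)
    show "continuous_on {d..L} F"
      using d(1) by (auto intro!: continuous_at_imp_continuous_on DERIV_isCont[OF F_deriv])
  qed (use dx in auto)
  then obtain l where l: "d \<le> l" "l \<le> L" "\<And>y. d \<le> y \<Longrightarrow> y \<le> L \<Longrightarrow> F y \<le> F l" by auto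
  have "w < F l" using l(3)[of x] dx F_iff[of x] x by simp
  then have dl: "d < l" "l < L" using between[of l] l d(1) by auto
  define r where "r = min (l - d) (L - l)"
  have "(2 * excess l * l\<^sup>2 - 2 * cgf l * (2 * l)) / (l\<^sup>2 * l\<^sup>2) = 0"
  proof (rule DERIV_local_max)
    show "(F has_real_derivative (2 * excess l * l\<^sup>2 - 2 * cgf l * (2 * l)) / (l\<^sup>2 * l\<^sup>2)) (at l)"
      using F_deriv dl d by simp
    show "0 < r" using dl by (simp add: r_def)
    show "\<forall>y. \<bar>l - y\<bar> < r \<longrightarrow> F y \<le> F l" using l(3) by (auto simp: r_def)
  qed
  then have "l * (l * excess l) = l * (2 * cgf l)"
    using dl d(1) by (simp add: power2_eq_square mult_ac)
  then have "2 * cgf l = l * excess l" using dl d(1) by simp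
  then show ?thesis using that[of l] dl d(1) F_iff[of l] \<open>w < F l\<close> by simp
qed

text \<open>If the bound fails, it fails at a stationary l, where \<open>kummer_ratio_ge\<close>
  applies. The shift of the mean cancels the linear term h * l of ln (1 + h * l), and the added h^2
  pays for the second-order loss (h * l)^2 / 2.\<close>

lemma kummer_dominated_step:
  assumes h: "0 < h" "a + s * h < s" and v: "kummer_dominated (a + s * h) s v" "tilted_var 0 \<le> v"
  shows "kummer_dominated a s (v + h\<^sup>2)"
proof (rule ccontr)
  assume "\<not> kummer_dominated a s (v + h\<^sup>2)"
  then obtain x where x: "0 < x" "(v + h\<^sup>2) * x\<^sup>2 / 2 < cgf x"
    by (auto simp: kummer_dominated_iff not_le)
  have "tilted_var 0 < v + h\<^sup>2" using v(2) h(1) zero_less_power[of h 2] by linarith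
  then obtain l where l: "0 < l" "2 * cgf l = l * excess l" "(v + h\<^sup>2) * l\<^sup>2 / 2 < cgf l"
    using stationary_ratio_exists x by blast
  define b where "b = a + s * h"
  interpret b: kummer_params b s
    unfolding b_def using a_pos s_pos h by unfold_locales (auto intro: add_pos_pos)
  have hl: "0 < 1 + h * l" using h l(1) by (intro add_pos_pos) auto
  have "kummer a s l * (1 + h * l) \<le> kummer b s l"
    using kummer_ratio_ge[OF l(1,2) h] kummer_pos[of l] l(1)
    by (simp add: b_def le_divide_eq mult.commute)
  then have "ln (kummer a s l * (1 + h * l)) \<le> ln (kummer b s l)"
    using kummer_pos[of l] hl l(1) by (intro ln_mono) auto
  then have "ln (kummer a s l) + ln (1 + h * l) \<le> ln (kummer b s l)"
    using kummer_pos[of l] l(1) hl by (simp add: ln_mult)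
  moreover have "h * l - (h * l)\<^sup>2 / 2 \<le> ln (1 + h * l)"
    using ln_add_one_ge_quadratic[of "h * l"] h l(1) by simp
  moreover have "b.cgf l \<le> v * l\<^sup>2 / 2"
    using v(1) l(1) by (simp add: b.kummer_dominated_iff flip: b_def)
  moreover have "b / s * l = a / s * l + h * l"
    using s_pos by (simp add: b_def add_divide_distrib distrib_right)
  ultimately have "cgf l \<le> v * l\<^sup>2 / 2 + (h * l)\<^sup>2 / 2"
    unfolding cgf_def b.cgf_def by linarith
  also have "\<dots> = (v + h\<^sup>2) * l\<^sup>2 / 2" by (simp add: algebra_simps power_mult_distrib)
  finally show False using l(3) by simp
qed

end

section \<open>Many small steps\<close>

lemma kummer_dominated_imp_ge:
  assumes "0 < a" "a < s" "kummer_dominated a s v"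
  shows "a / s * (1 - a / s) / (s + 1) \<le> v"
proof -
  interpret kummer_params a s using assms by unfold_locales auto
  show ?thesis using kummer_dominated_imp_var_le[OF assms(3)] by (simp add: tilted_var_0)
qed

text \<open>With p = a / s, the number p (1 - p) / (s + 1) is the variance of Beta(a, s - a), so
  this compares variances for two values of a.\<close>

lemma bernoulli_var_mono:
  fixes p q :: real
  assumes "p \<le> q" "p + q \<le> 1"
  shows "p * (1 - p) \<le> q * (1 - q)"
proof -
  have "0 \<le> (q - p) * (1 - (p + q))" using assms by (intro mult_nonneg_nonneg) auto
  then show ?thesis by (simp add: algebra_simps)
qed

text \<open>N + 1 steps of length s * h lead from b down to a, each costing h^2. As (N + 1) * h =
  \<delta>, the total cost is \<delta>^2 / (N + 1), which tends to 0.\<close>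

lemma kummer_dominated_antimono_half:
  assumes "0 < a" "a < b" "2 * b \<le> s" "kummer_dominated b s v"
  shows "kummer_dominated a s v"
proof -
  have s: "0 < s" using assms by simp
  define \<delta> where "\<delta> = (b - a) / s"
  have \<delta>: "0 < \<delta>" "b = a + s * \<delta>" using assms s by (auto simp: \<delta>_def)
  have vb: "b / s * (1 - b / s) / (s + 1) \<le> v"
    using kummer_dominated_imp_ge[of b s v] assms by simp
  have approx: "kummer_dominated a s (v + \<delta>\<^sup>2 / real (Suc N))" for N
  proof -
    define h where "h = \<delta> / real (Suc N)"
    have h: "0 < h" "h * real (Suc N) = \<delta>" using \<delta> by (auto simp: h_def)
    have "kummer_dominated (b - real j * (s * h)) s (v + real j * h\<^sup>2)" if "j \<le> Suc N" for j
      using that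
    proof (induction j)
      case (Suc j)
      let ?c = "b - real (Suc j) * (s * h)"
      have "real (Suc j) * h \<le> real (Suc N) * h" using Suc.prems h(1) by (intro mult_right_mono) auto
      then have "s * (real (Suc j) * h) \<le> s * \<delta>"
        using h(2) s by (intro mult_left_mono) (auto simp: mult.commute)
      then have "a \<le> ?c" using \<delta>(2) by (simp add: mult_ac)
      then have c: "0 < ?c" "?c < b" using assms(1) h(1) s by auto
      interpret c: kummer_params ?c s
        using c assms by unfold_locales auto
      have next_param: "?c + s * h = b - real j * (s * h)" by (simp add: algebra_simps)
      \<comment> \<open>A step requires the current constant to be at least the variance at the new
        parameter. The variance grows towards s / 2, so the bound \<open>vb\<close> at b is
        enough.\<close>
      have var: "c.tilted_var 0 \<le> v + real j * h\<^sup>2"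
      proof -
        have "?c / s + b / s \<le> 1"
          using c assms s by (simp add: divide_le_eq flip: add_divide_distrib)
        moreover have "?c / s \<le> b / s" using c s by (intro divide_right_mono) auto
        ultimately have "?c / s * (1 - ?c / s) \<le> b / s * (1 - b / s)"
          by (rule bernoulli_var_mono[rotated])
        then have "c.tilted_var 0 \<le> b / s * (1 - b / s) / (s + 1)"
          unfolding c.tilted_var_0 using s by (intro divide_right_mono) auto
        also have "\<dots> \<le> v" by (rule vb)
        finally show ?thesis by (simp add: add_increasing2)
      qed
      have "kummer_dominated ?c s (v + real j * h\<^sup>2 + h\<^sup>2)"
      proof (rule c.kummer_dominated_step[OF h(1) _ _ var])
        show "?c + s * h < s"
        proof -
          have "0 \<le> real j * (s * h)" using s h(1) by simp
          then show ?thesis unfolding next_param using assms by linarith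
        qed
        show "kummer_dominated (?c + s * h) s (v + real j * h\<^sup>2)"
          unfolding next_param using Suc by simp
      qed
      then show ?case by (simp add: algebra_simps)
    qed (use assms in simp)
    from this[of "Suc N"] have "kummer_dominated (b - s * (h * real (Suc N))) s
        (v + h * (h * real (Suc N)))"
      by (simp add: power2_eq_square mult_ac del: of_nat_Suc)
    then show ?thesis
      unfolding h(2) using \<delta>(2) by (simp add: h_def power2_eq_square del: of_nat_Suc)
  qed
  show ?thesis
    unfolding kummer_dominated_def
  proof (intro allI impI)
    fix x :: real assume "0 < x"
    \<comment> \<open>For fixed x the bound is a weak inequality, so it survives the limit.\<close>
    have "(\<lambda>N. \<delta>\<^sup>2 / real (Suc N)) \<longlonglongrightarrow> 0"
      by (intro LIMSEQ_Suc lim_const_over_n)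
    then have "(\<lambda>N. exp (a / s * x + (v + \<delta>\<^sup>2 / real (Suc N)) * x\<^sup>2 / 2)) \<longlonglongrightarrow>
        exp (a / s * x + (v + 0) * x\<^sup>2 / 2)"
      by (intro tendsto_intros) auto
    then have "kummer a s x \<le> exp (a / s * x + (v + 0) * x\<^sup>2 / 2)"
      by (rule LIMSEQ_le_const) (use approx \<open>0 < x\<close> in \<open>auto simp: kummer_dominated_def\<close>)
    then show "kummer a s x \<le> exp (a / s * x + v * x\<^sup>2 / 2)" by simp
  qed
qed

text \<open>By Kummer's transformation the second conjunct is the bound for negative arguments.\<close>

definition kummer_dominated_both :: "real \<Rightarrow> real \<Rightarrow> real \<Rightarrow> bool" where
  "kummer_dominated_both a s v \<longleftrightarrow> kummer_dominated a s v \<and> kummer_dominated (s - a) s v"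

lemma kummer_dominated_both_imp_ge:
  assumes "0 < a" "a < s" "kummer_dominated_both a s v"
  shows "a / s * (1 - a / s) / (s + 1) \<le> v"
  using kummer_dominated_imp_ge assms by (simp add: kummer_dominated_both_def)

lemma kummer_dominated_of_le_double:
  assumes "0 < a" "a < s" "s \<le> 2 * a" "a / s * (1 - a / s) / (s + 1) \<le> v"
  shows "kummer_dominated a s v"
proof -
  interpret kummer_params a s using assms by unfold_locales auto
  show ?thesis
    using assms s_pos by (intro kummer_dominated_of_half_le) (auto simp: tilted_var_0 field_simps)
qed

text \<open>The smaller of c and s - c is at most s / 2 and at least a, so monotonicity below s / 2
  gives the first half. Since 2 * a <= s, the parameter s - a is at least s / 2, where bounding the
  variance suffices.\<close>

lemma kummer_dominated_both_antimono:
  assumes "0 < a" "a \<le> c" "a + c \<le> s" "c < s" "kummer_dominated_both c s v"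
  shows "kummer_dominated_both a s v"
proof -
  have s: "0 < s" using assms by simp
  have "kummer_dominated a s v"
  proof -
    define m where "m = min c (s - c)"
    have m: "a \<le> m" "2 * m \<le> s" "kummer_dominated m s v"
      using assms by (auto simp: m_def min_def kummer_dominated_both_def)
    show ?thesis
      using kummer_dominated_antimono_half[of a m s v] m assms(1) by (cases "a = m") auto
  qed
  moreover have "kummer_dominated (s - a) s v"
  proof (rule kummer_dominated_of_le_double)
    have "a / s * (1 - a / s) \<le> c / s * (1 - c / s)"
      using assms s by (intro bernoulli_var_mono divide_right_mono)
        (auto simp: divide_le_eq simp flip: add_divide_distrib)
    then have "a / s * (1 - a / s) / (s + 1) \<le> c / s * (1 - c / s) / (s + 1)"
      using s by (intro divide_right_mono) auto
    also have "\<dots> \<le> v" using kummer_dominated_both_imp_ge[of c s v] assms by simp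
    finally show "(s - a) / s * (1 - (s - a) / s) / (s + 1) \<le> v"
      using s by (simp add: diff_divide_distrib mult.commute)
  qed (use assms in auto)
  ultimately show ?thesis by (simp add: kummer_dominated_both_def)
qed

section \<open>The least two-sided constant\<close>

text \<open>At s / 2 the variance is admissible; monotonicity carries it to smaller parameters and
  the symmetry between a and s - a to larger ones.\<close>

lemma kummer_dominated_both_exists:
  assumes "0 < a" "a < s"
  shows "\<exists>v. kummer_dominated_both a s v"
proof -
  \<comment> \<open>The constant is the variance of Beta(s / 2, s / 2).\<close>
  have half: "kummer_dominated_both (s / 2) s (1 / (4 * (s + 1)))"
    using kummer_dominated_of_le_double[of "s / 2" s "1 / (4 * (s + 1))"] assms
    by (simp add: kummer_dominated_both_def)
  have small: "\<exists>v. kummer_dominated_both c s v" if "0 < c" "2 * c \<le> s" for c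
    using kummer_dominated_both_antimono[of c "s / 2" s] half that by auto
  show ?thesis
    using small[of a] small[of "s - a"] assms by (cases "2 * a \<le> s") (auto simp: kummer_dominated_both_def)
qed

text \<open>The admissible v are cut out by the closed constraints 2 cgf x / x^2 <= v for the
  parameters a and s - a, so the infimum is attained; the variance bounds it from below.\<close>

lemma kummer_dominated_both_least:
  assumes "0 < a" "a < s"
  obtains v where "0 \<le> v" "kummer_dominated_both a s v"
    "\<And>w. kummer_dominated_both a s w \<Longrightarrow> v \<le> w"
proof -
  let ?S = "{v. kummer_dominated_both a s v}"
  have ne: "?S \<noteq> {}" using kummer_dominated_both_exists[OF assms] by simp
  have nonneg: "0 \<le> v" if "v \<in> ?S" for v
  proof -
    have "0 \<le> a / s * (1 - a / s) / (s + 1)" using assms by simp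
    also have "\<dots> \<le> v" using kummer_dominated_both_imp_ge[OF assms, of v] that by simp
    finally show ?thesis .
  qed
  then have bdd: "bdd_below ?S" by (intro bdd_belowI[of _ 0]) auto
  have closed: "kummer_dominated c s (Inf ?S)"
    if c: "0 < c" "c < s" and dom: "\<And>v. v \<in> ?S \<Longrightarrow> kummer_dominated c s v" for c
  proof -
    interpret kummer_params c s using c by unfold_locales
    have "cgf x \<le> Inf ?S * x\<^sup>2 / 2" if x: "0 < x" for x
    proof -
      have "2 * cgf x / x\<^sup>2 \<le> Inf ?S"
      proof (rule cInf_greatest[OF ne])
        fix v assume "v \<in> ?S"
        then have "cgf x \<le> v * x\<^sup>2 / 2" using dom x by (simp add: kummer_dominated_iff)
        then show "2 * cgf x / x\<^sup>2 \<le> v" using x by (simp add: divide_le_eq)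
      qed
      then show ?thesis using x by (simp add: divide_le_eq)
    qed
    then show ?thesis by (simp add: kummer_dominated_iff)
  qed
  show ?thesis
  proof (rule that[of "Inf ?S"])
    show "0 \<le> Inf ?S" using ne nonneg by (rule cInf_greatest)
    show "kummer_dominated_both a s (Inf ?S)"
      using closed[of a] closed[of "s - a"] assms by (simp add: kummer_dominated_both_def)
    show "Inf ?S \<le> w" if "kummer_dominated_both a s w" for w
      using that bdd by (intro cInf_lower) auto
  qed
qed

section \<open>Moments of the Beta and Dirichlet distributions\<close>

text \<open>At x = 0 both sides are 0, even for k = 0, because \<open>0 powr a\<close> is 0 for
  every a.\<close>

lemma powr_mult_power: "0 \<le> x \<Longrightarrow> x powr a * x ^ k = x powr (a + real k)" for x :: real
  by (cases "x = 0") (simp_all add: powr_add powr_realpow)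

lemma Beta_pos: "0 < a \<Longrightarrow> 0 < b \<Longrightarrow> 0 < Beta a b" for a b :: real
  by (simp add: Beta_def Gamma_real_pos)

text \<open>Substitution y -> t * y. The case t = 1 serves the Beta density; a variable t integrates
  out one coordinate of the Dirichlet density. For t = 0 both sides vanish by the convention for
  \<open>0 powr\<close>.\<close>

lemma nn_integral_Beta_scaled:
  fixes a b t :: real
  assumes "0 < a" "0 < b" "0 \<le> t"
  shows "(\<integral>\<^sup>+y. ennreal (if 0 \<le> y \<and> y \<le> t then y powr (a - 1) * (t - y) powr (b - 1) else 0) \<partial>lborel)
    = ennreal (Beta a b * t powr (a + b - 1))"
proof (cases "t = 0")
  case True
  then have "(if 0 \<le> y \<and> y \<le> t then y powr (a - 1) * (t - y) powr (b - 1) else 0) = 0" for y :: real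
    by auto
  then show ?thesis using True by (simp cong: if_cong)
next
  case False
  then have t: "0 < t" using assms by simp
  let ?f = "\<lambda>t y. if 0 \<le> y \<and> y \<le> t then y powr (a - 1) * (t - y) powr (b - 1) else 0 :: real"
  have scale: "?f t (t * y) = t powr (a + b - 2) * ?f 1 y" for y
  proof (cases "0 \<le> y \<and> y \<le> 1")
    case True
    have "t - t * y = t * (1 - y)" by (simp add: algebra_simps)
    moreover have "t powr (a - 1) * t powr (b - 1) = t powr (a + b - 2)"
      by (simp flip: powr_add)
    ultimately show ?thesis using True t
      by (simp add: powr_mult mult_ac)
  qed (use t in \<open>auto simp: zero_le_mult_iff\<close>)
  have "(\<integral>\<^sup>+y. ennreal (?f t y) \<partial>lborel) = ennreal \<bar>t\<bar> * (\<integral>\<^sup>+y. ennreal (?f t (0 + t * y)) \<partial>lborel)"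
    using t by (intro nn_integral_real_affine) auto
  also have "\<dots> = ennreal t * (\<integral>\<^sup>+y. ennreal (t powr (a + b - 2)) * ennreal (?f 1 y) \<partial>lborel)"
    using t by (simp only: add_0 scale abs_of_pos) (subst ennreal_mult', auto)
  also have "\<dots> = ennreal t * (ennreal (t powr (a + b - 2)) * (\<integral>\<^sup>+y. ennreal (?f 1 y) \<partial>lborel))"
    by (subst nn_integral_cmult) auto
  also have "(\<integral>\<^sup>+y. ennreal (?f 1 y) \<partial>lborel) =
      (\<integral>\<^sup>+y. ennreal (indicator {0..1} y * (y powr (a - 1) * (1 - y) powr (b - 1))) \<partial>lborel)"
    by (intro nn_integral_cong) (auto simp: indicator_def)
  also have "\<dots> = ennreal (Beta a b)"
    using nn_integral_has_integral_lebesgue[OF _ has_integral_Beta_real[OF assms(1,2)]] by simp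
  also have "ennreal t * (ennreal (t powr (a + b - 2)) * ennreal (Beta a b)) =
      ennreal (Beta a b * (t * t powr (a + b - 2)))"
    using t Beta_pos[OF assms(1,2)] by (simp add: mult_ac flip: ennreal_mult)
  also have "t * t powr (a + b - 2) = t powr (a + b - 1)"
    using t powr_add[of t 1 "a + b - 2"] by simp
  finally show ?thesis .
qed

text \<open>Mixed moments cover the variable and its reflection 1 - x together; j = k = 0 gives
  total mass 1.\<close>

lemma nn_integral_beta_distribution:
  fixes a b :: real
  assumes "0 < a" "0 < b"
  shows "(\<integral>\<^sup>+x. ennreal (x ^ j * (1 - x) ^ k) \<partial>beta_distribution a b) =
    ennreal (Beta (a + real j) (b + real k) / Beta a b)"
proof -
  let ?f = "\<lambda>y::real. if 0 \<le> y \<and> y \<le> 1 then y powr (a + real j - 1) * (1 - y) powr (b + real k - 1) else 0"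
  have B: "0 < Beta a b" using Beta_pos assms by simp
  have dens: "indicator {0..1} x * (Gamma (a + b) / (Gamma a * Gamma b) *
      x powr (a - 1) * (1 - x) powr (b - 1)) * (x ^ j * (1 - x) ^ k) = 1 / Beta a b * ?f x" for x :: real
  proof (cases "0 \<le> x \<and> x \<le> 1")
    case True
    have "x powr (a + real j - 1) = x powr (a - 1) * x ^ j"
      "(1 - x) powr (b + real k - 1) = (1 - x) powr (b - 1) * (1 - x) ^ k"
      using True powr_mult_power[of x "a - 1" j] powr_mult_power[of "1 - x" "b - 1" k]
      by (simp_all add: algebra_simps)
    then show ?thesis using True by (simp add: Beta_def)
  qed auto
  have "(\<integral>\<^sup>+x. ennreal (x ^ j * (1 - x) ^ k) \<partial>beta_distribution a b) =
      (\<integral>\<^sup>+x. ennreal (indicator {0..1} x * (Gamma (a + b) / (Gamma a * Gamma b) *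
        x powr (a - 1) * (1 - x) powr (b - 1))) * ennreal (x ^ j * (1 - x) ^ k) \<partial>lborel)"
    unfolding beta_distribution_def by (subst nn_integral_density) auto
  also have "\<dots> = (\<integral>\<^sup>+x. ennreal (1 / Beta a b) * ennreal (?f x) \<partial>lborel)"
  proof (rule nn_integral_cong)
    fix x :: real
    have "0 \<le> indicator {0..1} x * (Gamma (a + b) / (Gamma a * Gamma b) *
        x powr (a - 1) * (1 - x) powr (b - 1))"
      using assms by (simp add: Gamma_real_pos less_imp_le)
    moreover have "0 \<le> 1 / Beta a b" using B by simp
    ultimately show "ennreal (indicator {0..1} x * (Gamma (a + b) / (Gamma a * Gamma b) *
        x powr (a - 1) * (1 - x) powr (b - 1))) * ennreal (x ^ j * (1 - x) ^ k) =
        ennreal (1 / Beta a b) * ennreal (?f x)"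
      by (simp only: dens flip: ennreal_mult')
  qed
  also have "\<dots> = ennreal (1 / Beta a b) * ennreal (Beta (a + real j) (b + real k) * 1 powr (a + real j + (b + real k) - 1))"
    using nn_integral_Beta_scaled[of "a + real j" "b + real k" 1] assms
    by (subst nn_integral_cmult) auto
  also have "\<dots> = ennreal (Beta (a + real j) (b + real k) / Beta a b)"
    using B by (simp flip: ennreal_mult')
  finally show ?thesis .
qed

lemma Beta_ratio:
  fixes a b :: real
  assumes "0 < a" "0 < b"
  shows "Beta (a + real k) b / Beta a b = pochhammer a k / pochhammer (a + b) k"
proof -
  have "a \<notin> \<int>\<^sub>\<le>\<^sub>0" "a + b \<notin> \<int>\<^sub>\<le>\<^sub>0" using assms by (auto elim!: nonpos_Ints_cases)
  then show ?thesis
    using Gamma_real_pos[OF assms(1)] Gamma_real_pos[OF assms(2)]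
    by (simp add: Beta_def pochhammer_Gamma add_ac)
qed

lemma prob_space_beta_distribution:
  assumes "0 < a" "0 < b"
  shows "prob_space (beta_distribution a b)"
proof
  show "emeasure (beta_distribution a b) (space (beta_distribution a b)) = 1"
    using nn_integral_beta_distribution[OF assms, of 0 0] Beta_pos[OF assms] by simp
qed

lemma AE_beta_distribution: "AE x in beta_distribution a b. 0 \<le> x \<and> x \<le> 1"
  unfolding beta_distribution_def by (subst AE_density) (auto simp: indicator_def)

section \<open>From moments to sub-Gaussian bounds\<close>

text \<open>Beta variables, their reflections and the coordinates of a Dirichlet vector are all
  instances. On [0, 1] the moments, those of Beta(a, s - a), determine the moment generating
  function.\<close>

locale beta_moments = prob_space M + kummer_params a s
  for M :: "'a measure" and a s :: real +
  fixes X :: "'a \<Rightarrow> real"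
  assumes measurable_X [measurable]: "X \<in> borel_measurable M"
    and AE_X: "AE \<omega> in M. 0 \<le> X \<omega> \<and> X \<omega> \<le> 1"
    and moments: "\<And>k. (\<integral>\<^sup>+\<omega>. ennreal (X \<omega> ^ k) \<partial>M) = ennreal (pochhammer a k / pochhammer s k)"
begin

lemma integrable_power: "integrable M (\<lambda>\<omega>. X \<omega> ^ k)"
proof (rule integrable_const_bound[of _ 1])
  show "AE \<omega> in M. norm (X \<omega> ^ k) \<le> 1"
    using AE_X by eventually_elim (simp add: power_le_one)
qed simp

lemma integrable_exp_affine: "integrable M (\<lambda>\<omega>. exp (l * (X \<omega> - c)))"
proof (rule integrable_const_bound[of _ "exp (\<bar>l\<bar> * (1 + \<bar>c\<bar>))"])
  show "AE \<omega> in M. norm (exp (l * (X \<omega> - c))) \<le> exp (\<bar>l\<bar> * (1 + \<bar>c\<bar>))"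
    using AE_X
  proof eventually_elim
    case (elim \<omega>)
    have "l * (X \<omega> - c) \<le> \<bar>l\<bar> * \<bar>X \<omega> - c\<bar>" by (metis abs_ge_self abs_mult)
    also have "\<dots> \<le> \<bar>l\<bar> * (1 + \<bar>c\<bar>)" using elim by (intro mult_left_mono) auto
    finally show ?case by simp
  qed
qed simp

lemma integral_power: "(\<integral>\<omega>. X \<omega> ^ k \<partial>M) = pochhammer a k / pochhammer s k"
proof -
  have "AE \<omega> in M. 0 \<le> X \<omega> ^ k" using AE_X by eventually_elim simp
  then have "(\<integral>\<omega>. X \<omega> ^ k \<partial>M) = enn2real (\<integral>\<^sup>+\<omega>. ennreal (X \<omega> ^ k) \<partial>M)"
    by (intro integral_eq_nn_integral) auto
  also have "\<dots> = pochhammer a k / pochhammer s k"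
    using pochhammer_pos[OF a_pos, of k] pochhammer_pos[OF s_pos, of k] by (simp add: moments)
  finally show ?thesis .
qed

text \<open>The exponential series is integrated term by term; as X lies in [0, 1] almost
  everywhere, |l|^i / i! is a summable majorant.\<close>

lemma mgf: "(\<integral>\<omega>. exp (l * X \<omega>) \<partial>M) = kummer a s l"
proof -
  let ?f = "\<lambda>i \<omega>. l ^ i / fact i * X \<omega> ^ i"
  have exp_sums: "(\<lambda>i. ?f i \<omega>) sums exp (l * X \<omega>)" for \<omega>
    using exp_converges[of "l * X \<omega>"] by (simp add: power_mult_distrib divide_inverse mult_ac)
  have "(\<lambda>i. integral\<^sup>L M (?f i)) sums (\<integral>\<omega>. (\<Sum>i. ?f i \<omega>) \<partial>M)"
  proof (rule sums_integral)
    show "integrable M (?f i)" for i using integrable_power by simp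
    show "AE \<omega> in M. summable (\<lambda>i. norm (?f i \<omega>))"
    proof (rule AE_I2)
      show "summable (\<lambda>i. norm (?f i \<omega>))" for \<omega>
        using summable_norm_exp[of "l * X \<omega>"]
        by (simp add: power_mult_distrib divide_inverse abs_mult power_abs mult_ac)
    qed
    show "summable (\<lambda>i. \<integral>\<omega>. norm (?f i \<omega>) \<partial>M)"
    proof (rule summable_comparison_test')
      show "summable (\<lambda>i. \<bar>l\<bar> ^ i / fact i)"
        using summable_exp[of "\<bar>l\<bar>"] by (simp add: field_simps)
      show "norm (\<integral>\<omega>. norm (?f i \<omega>) \<partial>M) \<le> \<bar>l\<bar> ^ i / fact i" if "0 \<le> i" for i
      proof -
        have "(\<integral>\<omega>. norm (?f i \<omega>) \<partial>M) \<le> (\<integral>\<omega>. \<bar>l\<bar> ^ i / fact i \<partial>M)"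
        proof (rule integral_mono_AE)
          show "integrable M (\<lambda>\<omega>. norm (?f i \<omega>))" using integrable_power by (intro integrable_norm) simp
          show "AE \<omega> in M. norm (?f i \<omega>) \<le> \<bar>l\<bar> ^ i / fact i"
            using AE_X
          proof eventually_elim
            case (elim \<omega>)
            then have "\<bar>l\<bar> ^ i / fact i * X \<omega> ^ i \<le> \<bar>l\<bar> ^ i / fact i * 1"
              by (intro mult_left_mono) (auto simp: power_le_one)
            then show ?case using elim by (simp add: abs_mult power_abs)
          qed
        qed simp
        then show ?thesis by (simp add: prob_space)
      qed
    qed
  qed
  moreover have "(\<Sum>i. ?f i \<omega>) = exp (l * X \<omega>)" for \<omega>
    using exp_sums[of \<omega>] by (simp add: sums_iff)
  moreover have "integral\<^sup>L M (?f i) = kummer_coeff a s i * l ^ i" for i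
    by (simp add: integral_power kummer_coeff_def)
  ultimately have "(\<lambda>i. kummer_coeff a s i * l ^ i) sums (\<integral>\<omega>. exp (l * X \<omega>) \<partial>M)" by simp
  then show ?thesis by (simp add: kummer_def sums_iff)
qed

end

lemma beta_moments_beta_distribution:
  assumes "0 < a" "0 < b"
  shows "beta_moments (beta_distribution a b) a (a + b) (\<lambda>x. x)"
proof -
  interpret prob_space "beta_distribution a b" using prob_space_beta_distribution assms by simp
  show ?thesis
  proof
    show "(\<lambda>x. x) \<in> borel_measurable (beta_distribution a b)"
      by (simp add: beta_distribution_def)
    show "(\<integral>\<^sup>+x. ennreal (x ^ k) \<partial>beta_distribution a b) =
        ennreal (pochhammer a k / pochhammer (a + b) k)" for k
      using nn_integral_beta_distribution[OF assms, of k 0] Beta_ratio[OF assms, of k] by simp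
  qed (use assms AE_beta_distribution in auto)
qed

lemma beta_moments_beta_distribution_reflected:
  assumes "0 < a" "0 < b"
  shows "beta_moments (beta_distribution a b) b (a + b) (\<lambda>x. 1 - x)"
proof -
  interpret prob_space "beta_distribution a b" using prob_space_beta_distribution assms by simp
  show ?thesis
  proof
    show "(\<lambda>x. 1 - x) \<in> borel_measurable (beta_distribution a b)"
      by (simp add: beta_distribution_def)
    show "AE x in beta_distribution a b. 0 \<le> 1 - x \<and> 1 - x \<le> 1"
      using AE_beta_distribution[of a b] by eventually_elim simp
    show "(\<integral>\<^sup>+x. ennreal ((1 - x) ^ k) \<partial>beta_distribution a b) =
        ennreal (pochhammer b k / pochhammer (a + b) k)" for k
      using nn_integral_beta_distribution[OF assms, of 0 k] Beta_ratio[OF assms(2,1), of k]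
      by (simp add: Beta_commute add.commute)
  qed (use assms in auto)
qed

text \<open>Under Beta(a, s - a) both sides are expectations: E exp(-x X) = exp(-x) E exp(x (1 -
  X)), and 1 - X has the moments with a and s - a interchanged.\<close>

lemma kummer_transformation:
  assumes "0 < a" "a < s"
  shows "kummer a s (- x) = exp (- x) * kummer (s - a) s x"
proof -
  have ab: "0 < a" "0 < s - a" "a + (s - a) = s" using assms by auto
  interpret B: beta_moments "beta_distribution a (s - a)" a s "\<lambda>x. x"
    using beta_moments_beta_distribution[OF ab(1,2)] ab(3) by simp
  interpret R: beta_moments "beta_distribution a (s - a)" "s - a" s "\<lambda>x. 1 - x"
    using beta_moments_beta_distribution_reflected[OF ab(1,2)] ab(3) by simp
  have "kummer a s (- x) = (\<integral>y. exp (- x) * exp (x * (1 - y)) \<partial>beta_distribution a (s - a))"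
    unfolding B.mgf[symmetric] by (simp add: algebra_simps flip: exp_add)
  also have "\<dots> = exp (- x) * kummer (s - a) s x"
    using R.mgf[of x] by simp
  finally show ?thesis .
qed

context beta_moments
begin

text \<open>Positive l give the first half directly. Kummer's transformation turns negative l into
  positive arguments for the parameter s - a, whose mean is 1 - a / s.\<close>

lemma sub_gaussian_iff: "sub_gaussian M X v \<longleftrightarrow> kummer_dominated_both a s v"
proof -
  have mean: "integral\<^sup>L M X = a / s" using integral_power[of 1] by simp
  have mgf_centered: "(\<integral>\<omega>. exp (l * (X \<omega> - a / s)) \<partial>M) = exp (- (l * (a / s))) * kummer a s l" for l
  proof -
    have "(\<integral>\<omega>. exp (l * (X \<omega> - a / s)) \<partial>M) = (\<integral>\<omega>. exp (- (l * (a / s))) * exp (l * X \<omega>) \<partial>M)"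
      by (simp add: algebra_simps flip: exp_add)
    then show ?thesis using mgf[of l] by simp
  qed
  have "sub_gaussian M X v \<longleftrightarrow>
      (\<forall>l. exp (- (l * (a / s))) * kummer a s l \<le> exp (l\<^sup>2 * v / 2))"
    unfolding sub_gaussian_def mean mgf_centered
    using prob_space_axioms integrable_power[of 1] integrable_exp_affine by simp
  also have "\<dots> \<longleftrightarrow> (\<forall>l. kummer a s l \<le> exp (a / s * l + v * l\<^sup>2 / 2))"
    by (simp add: exp_minus field_simps flip: exp_add)
  also have "\<dots> \<longleftrightarrow> kummer_dominated_both a s v"
  proof -
    have neg: "kummer a s (- x) \<le> exp (a / s * (- x) + v * (- x)\<^sup>2 / 2) \<longleftrightarrow>
        kummer (s - a) s x \<le> exp ((s - a) / s * x + v * x\<^sup>2 / 2)" for x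
    proof -
      have "a / s * (- x) + v * (- x)\<^sup>2 / 2 = - x + ((s - a) / s * x + v * x\<^sup>2 / 2)"
        using s_pos by (simp add: diff_divide_distrib left_diff_distrib)
      then have "exp (a / s * (- x) + v * (- x)\<^sup>2 / 2) =
          exp (- x) * exp ((s - a) / s * x + v * x\<^sup>2 / 2)"
        by (simp only: exp_add)
      then show ?thesis
        by (simp only: kummer_transformation[OF a_pos a_less] mult_le_cancel_left_pos exp_gt_zero)
    qed
    show ?thesis
    proof
      assume *: "\<forall>l. kummer a s l \<le> exp (a / s * l + v * l\<^sup>2 / 2)"
      then have "kummer (s - a) s x \<le> exp ((s - a) / s * x + v * x\<^sup>2 / 2)" for x
        using neg[of x] by blast
      then show "kummer_dominated_both a s v"
        using * by (simp add: kummer_dominated_both_def kummer_dominated_def)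
    next
      assume *: "kummer_dominated_both a s v"
      show "\<forall>l. kummer a s l \<le> exp (a / s * l + v * l\<^sup>2 / 2)"
      proof
        fix l :: real
        consider "0 < l" | "l = 0" | "l < 0" by linarith
        then show "kummer a s l \<le> exp (a / s * l + v * l\<^sup>2 / 2)"
        proof cases
          case 3
          then have "kummer (s - a) s (- l) \<le> exp ((s - a) / s * (- l) + v * (- l)\<^sup>2 / 2)"
            using * by (simp only: kummer_dominated_both_def kummer_dominated_def neg_0_less_iff_less)
          then show ?thesis using neg[of "- l"] by simp
        qed (use * in \<open>auto simp: kummer_dominated_both_def kummer_dominated_def kummer_0\<close>)
      qed
    qed
  qed
  finally show ?thesis .
qed

end

section \<open>Dirichlet integrals\<close>

text \<open>Induction on the number of coordinates. Integrating out the last one is a scaled Beta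
  integral that merges the parameters \<alpha> n and \<beta> into \<alpha> n + \<beta>; hence
  \<beta> is generalised.\<close>

lemma nn_integral_dirichlet_kernel:
  fixes \<alpha> :: "nat \<Rightarrow> real"
  assumes "\<And>i. i < n \<Longrightarrow> 0 < \<alpha> i" "0 < \<beta>"
  shows "(\<integral>\<^sup>+x. ennreal (if (\<forall>i<n. 0 \<le> x i) \<and> (\<Sum>i<n. x i) \<le> 1
      then (\<Prod>i<n. x i powr (\<alpha> i - 1)) * (1 - (\<Sum>i<n. x i)) powr (\<beta> - 1) else 0)
      \<partial>(\<Pi>\<^sub>M i\<in>{..<n}. lborel))
    = ennreal ((\<Prod>i<n. Gamma (\<alpha> i)) * Gamma \<beta> / Gamma ((\<Sum>i<n. \<alpha> i) + \<beta>))"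
  using assms
proof (induction n arbitrary: \<beta>)
  case 0
  \<comment> \<open>Without coordinates the integral runs over a one-point space and the integrand
    is \<open>1 powr (\<beta> - 1)\<close>, that is 1.\<close>
  have "Gamma \<beta> \<noteq> 0" using Gamma_real_pos[OF 0(2)] by linarith
  then show ?case
    by (simp add: PiM_empty nn_integral_count_space_finite)
next
  case (Suc n)
  interpret product_sigma_finite "\<lambda>i::nat. lborel :: real measure" ..
  let ?S = "\<lambda>x. \<Sum>i<n. x i :: real"
  let ?pos = "\<lambda>x :: nat \<Rightarrow> real. \<forall>i<n. 0 \<le> x i"
  let ?P = "\<lambda>x. \<Prod>i<n. x i powr (\<alpha> i - 1)"
  let ?f = "\<lambda>x. if (\<forall>i<Suc n. 0 \<le> x i) \<and> (\<Sum>i<Suc n. x i) \<le> 1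
      then (\<Prod>i<Suc n. x i powr (\<alpha> i - 1)) * (1 - (\<Sum>i<Suc n. x i)) powr (\<beta> - 1) else (0::real)"
  let ?g = "\<lambda>x. if ?pos x \<and> ?S x \<le> 1 then ?P x * (1 - ?S x) powr (\<alpha> n + \<beta> - 1) else 0"
  have B: "0 < Beta (\<alpha> n) \<beta>" using Suc.prems by (intro Beta_pos) auto
  have upd: "(\<Sum>i<n. (x(n := y)) i) = ?S x" "(\<Prod>i<n. (x(n := y)) i powr (\<alpha> i - 1)) = ?P x"
    for x :: "nat \<Rightarrow> real" and y by (auto intro!: sum.cong prod.cong)
  have inner: "(\<integral>\<^sup>+y. ennreal (?f (x(n := y))) \<partial>lborel) = ennreal (Beta (\<alpha> n) \<beta>) * ennreal (?g x)" for x
  proof (cases "?pos x \<and> ?S x \<le> 1")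
    case True
    let ?k = "\<lambda>y. if 0 \<le> y \<and> y \<le> 1 - ?S x
      then y powr (\<alpha> n - 1) * (1 - ?S x - y) powr (\<beta> - 1) else 0"
    have P: "0 \<le> ?P x" by (intro prod_nonneg) auto
    have "?f (x(n := y)) = ?P x * ?k y" for y
    proof -
      have pos: "(\<forall>i<Suc n. 0 \<le> (x(n := y)) i) \<longleftrightarrow> 0 \<le> y"
        using True by (auto simp: less_Suc_eq)
      show ?thesis
        by (simp only: pos sum.lessThan_Suc prod.lessThan_Suc upd fun_upd_same) (auto simp: algebra_simps)
    qed
    then have "(\<integral>\<^sup>+y. ennreal (?f (x(n := y))) \<partial>lborel) = (\<integral>\<^sup>+y. ennreal (?P x) * ennreal (?k y) \<partial>lborel)"
      using P by (simp only: ennreal_mult')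
    also have "\<dots> = ennreal (?P x) * ennreal (Beta (\<alpha> n) \<beta> * (1 - ?S x) powr (\<alpha> n + \<beta> - 1))"
      using True Suc.prems by (subst nn_integral_cmult) (auto simp: nn_integral_Beta_scaled)
    also have "\<dots> = ennreal (Beta (\<alpha> n) \<beta>) * ennreal (?g x)"
      using True P B by (simp add: mult_ac flip: ennreal_mult)
    finally show ?thesis .
  next
    case False
    have zero: "?f (x(n := y)) = 0" for y
    proof -
      have "\<not> ((\<forall>i<Suc n. 0 \<le> (x(n := y)) i) \<and> (\<Sum>i<Suc n. (x(n := y)) i) \<le> 1)"
        using False unfolding sum.lessThan_Suc upd by (force simp: less_Suc_eq)
      then show ?thesis by (rule if_not_P)
    qed
    show ?thesis unfolding zero if_not_P[OF False] by simp
  qed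
  have "(\<integral>\<^sup>+x. ennreal (?f x) \<partial>(\<Pi>\<^sub>M i\<in>{..<Suc n}. lborel)) =
      (\<integral>\<^sup>+x. (\<integral>\<^sup>+y. ennreal (?f (x(n := y))) \<partial>lborel) \<partial>(\<Pi>\<^sub>M i\<in>{..<n}. lborel))"
  proof (rule product_nn_integral_insert[of "{..<n}" n "\<lambda>x. ennreal (?f x)", folded lessThan_Suc])
    show "(\<lambda>x. ennreal (?f x)) \<in> borel_measurable (\<Pi>\<^sub>M i\<in>{..<Suc n}. lborel)"
      by measurable
  qed auto
  also have "\<dots> = (\<integral>\<^sup>+x. ennreal (Beta (\<alpha> n) \<beta>) * ennreal (?g x) \<partial>(\<Pi>\<^sub>M i\<in>{..<n}. lborel))"
    by (simp only: inner)
  also have "\<dots> = ennreal (Beta (\<alpha> n) \<beta>) * (\<integral>\<^sup>+x. ennreal (?g x) \<partial>(\<Pi>\<^sub>M i\<in>{..<n}. lborel))"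
    by (rule nn_integral_cmult) measurable
  also have "\<dots> = ennreal (Beta (\<alpha> n) \<beta>) * ennreal
      ((\<Prod>i<n. Gamma (\<alpha> i)) * Gamma (\<alpha> n + \<beta>) / Gamma ((\<Sum>i<n. \<alpha> i) + (\<alpha> n + \<beta>)))"
    using Suc.prems by (subst Suc.IH) (auto simp: add_pos_pos)
  also have "\<dots> = ennreal ((\<Prod>i<Suc n. Gamma (\<alpha> i)) * Gamma \<beta> / Gamma ((\<Sum>i<Suc n. \<alpha> i) + \<beta>))"
  proof -
    have "0 < Gamma (\<alpha> n + \<beta>)" using Suc.prems by (intro Gamma_real_pos add_pos_pos) auto
    then show ?thesis
      using B by (simp add: Beta_def add_ac mult_ac flip: ennreal_mult')
  qed
  finally show ?case .
qed

lemma prob_simplex_sets [measurable]: "prob_simplex d \<in> sets (\<Pi>\<^sub>M i\<in>{..<d}. borel)"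
proof -
  have "prob_simplex d = {u \<in> space (\<Pi>\<^sub>M i\<in>{..<d}. borel).
      (\<forall>i<d. 0 \<le> u i \<and> u i \<le> 1) \<and> (\<Sum>i<d. u i) = (1::real)}"
    by (fastforce simp: prob_simplex_def space_PiM PiE_iff)
  also have "\<dots> \<in> sets (\<Pi>\<^sub>M i\<in>{..<d}. borel)" by measurable
  finally show ?thesis .
qed

text \<open>Pulling back along the parametrisation \<open>\<phi>\<close> eliminates the last
  coordinate and leaves the kernel of \<open>nn_integral_dirichlet_kernel\<close>, with the last
  parameter as \<beta>.\<close>

lemma nn_integral_hyperplane_lebesgue:
  fixes \<alpha> :: "nat \<Rightarrow> real"
  assumes "1 \<le> d" "\<And>i. i < d \<Longrightarrow> 0 < \<alpha> i"
  shows "(\<integral>\<^sup>+x. ennreal (indicator (prob_simplex d) x * (\<Prod>i<d. x i powr (\<alpha> i - 1)))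
    \<partial>hyperplane_lebesgue d) = ennreal (multivariate_Beta d \<alpha>)"
proof -
  obtain m where d: "d = Suc m" using assms(1) by (cases d) auto
  let ?S = "\<lambda>x. \<Sum>i<m. x i :: real"
  define \<phi> :: "(nat \<Rightarrow> real) \<Rightarrow> nat \<Rightarrow> real" where
    "\<phi> x = (\<lambda>i\<in>{..<d}. if i = m then 1 - (\<Sum>j<m. x j) else x i)" for x
  have \<phi>_less: "\<phi> x i = x i" if "i < m" for x i using that by (simp add: \<phi>_def d)
  have \<phi>_last: "\<phi> x m = 1 - ?S x" for x by (simp add: \<phi>_def d)
  have \<phi>_sum: "(\<Sum>i<d. \<phi> x i) = 1" for x
    by (simp add: d \<phi>_last \<phi>_less)
  have \<phi>_simplex: "\<phi> x \<in> prob_simplex d \<longleftrightarrow> (\<forall>i<m. 0 \<le> x i) \<and> ?S x \<le> 1" for x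
  proof
    assume "\<phi> x \<in> prob_simplex d"
    then have "\<forall>i<d. 0 \<le> \<phi> x i" by (auto simp: prob_simplex_def PiE_iff)
    then show "(\<forall>i<m. 0 \<le> x i) \<and> ?S x \<le> 1"
      using \<phi>_less \<phi>_last by (auto simp: d less_Suc_eq)
  next
    assume x: "(\<forall>i<m. 0 \<le> x i) \<and> ?S x \<le> 1"
    then have nonneg: "0 \<le> \<phi> x i" if "i < d" for i
      using that by (auto simp: d less_Suc_eq \<phi>_less \<phi>_last)
    have "\<phi> x i \<le> 1" if "i < d" for i
      using member_le_sum[of i "{..<d}" "\<phi> x"] nonneg that \<phi>_sum[of x] by auto
    then show "\<phi> x \<in> prob_simplex d"
      using nonneg \<phi>_sum[of x] by (auto simp: prob_simplex_def \<phi>_def)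
  qed
  have \<phi>_meas [measurable]: "\<phi> \<in> (\<Pi>\<^sub>M i\<in>{..<m}. lborel) \<rightarrow>\<^sub>M (\<Pi>\<^sub>M i\<in>{..<d}. borel)"
    unfolding \<phi>_def[abs_def] d
  proof (rule measurable_restrict)
    fix i assume i: "i \<in> {..<Suc m}"
    show "(\<lambda>x. if i = m then 1 - (\<Sum>j<m. x j) else x i) \<in> (\<Pi>\<^sub>M i\<in>{..<m}. lborel) \<rightarrow>\<^sub>M borel"
    proof (cases "i = m")
      case False
      then have "i \<in> {..<m}" using i by simp
      then show ?thesis using False by (simp add: measurable_component_singleton)
    qed simp
  qed
  have hyperplane: "hyperplane_lebesgue d = distr (\<Pi>\<^sub>M i\<in>{..<m}. lborel) (\<Pi>\<^sub>M i\<in>{..<d}. borel) \<phi>"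
    unfolding hyperplane_lebesgue_def \<phi>_def[abs_def] d diff_Suc_1 ..
  have "(\<integral>\<^sup>+x. ennreal (indicator (prob_simplex d) x * (\<Prod>i<d. x i powr (\<alpha> i - 1)))
      \<partial>hyperplane_lebesgue d) =
    (\<integral>\<^sup>+x. ennreal (indicator (prob_simplex d) (\<phi> x) * (\<Prod>i<d. \<phi> x i powr (\<alpha> i - 1)))
      \<partial>(\<Pi>\<^sub>M i\<in>{..<m}. lborel))"
    unfolding hyperplane by (rule nn_integral_distr) measurable
  also have "\<dots> = (\<integral>\<^sup>+x. ennreal (if (\<forall>i<m. 0 \<le> x i) \<and> ?S x \<le> 1
      then (\<Prod>i<m. x i powr (\<alpha> i - 1)) * (1 - ?S x) powr (\<alpha> m - 1) else 0)
      \<partial>(\<Pi>\<^sub>M i\<in>{..<m}. lborel))"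
  proof (rule nn_integral_cong)
    fix x :: "nat \<Rightarrow> real"
    have "(\<Prod>i<d. \<phi> x i powr (\<alpha> i - 1)) = (\<Prod>i<m. x i powr (\<alpha> i - 1)) * (1 - ?S x) powr (\<alpha> m - 1)"
      by (simp add: d \<phi>_less \<phi>_last)
    then show "ennreal (indicator (prob_simplex d) (\<phi> x) * (\<Prod>i<d. \<phi> x i powr (\<alpha> i - 1))) =
        ennreal (if (\<forall>i<m. 0 \<le> x i) \<and> ?S x \<le> 1
          then (\<Prod>i<m. x i powr (\<alpha> i - 1)) * (1 - ?S x) powr (\<alpha> m - 1) else 0)"
      by (cases "\<phi> x \<in> prob_simplex d")
         (simp_all only: \<phi>_simplex[symmetric] indicator_simps simp_thms if_True if_False mult_1 mult_zero_left)
  qed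
  also have "\<dots> = ennreal (multivariate_Beta d \<alpha>)"
    using assms by (subst nn_integral_dirichlet_kernel) (auto simp: d multivariate_Beta_def)
  finally show ?thesis .
qed

lemma multivariate_Beta_pos:
  assumes "1 \<le> d" "\<And>i. i < d \<Longrightarrow> 0 < \<alpha> i"
  shows "0 < multivariate_Beta d \<alpha>"
proof -
  have "0 < (\<Sum>i<d. \<alpha> i)" using assms by (intro sum_pos) (auto simp: lessThan_empty_iff)
  then show ?thesis
    unfolding multivariate_Beta_def using assms
    by (intro divide_pos_pos prod_pos ballI Gamma_real_pos) auto
qed

text \<open>Raising one parameter by k affects one Gamma factor and the Gamma value of the total;
  each quotient is a Pochhammer symbol.\<close>

lemma multivariate_Beta_ratio:
  assumes "\<And>i. i < d \<Longrightarrow> 0 < \<alpha> i" "j < d"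
  shows "multivariate_Beta d (\<alpha>(j := \<alpha> j + real k)) / multivariate_Beta d \<alpha> =
    pochhammer (\<alpha> j) k / pochhammer (\<Sum>i<d. \<alpha> i) k"
proof -
  let ?s = "\<Sum>i<d. \<alpha> i" and ?\<beta> = "\<alpha>(j := \<alpha> j + real k)"
  define Q where "Q = (\<Prod>i\<in>{..<d} - {j}. Gamma (\<alpha> i))"
  have s: "0 < ?s" using assms by (intro sum_pos) auto
  have j: "0 < \<alpha> j" using assms by simp
  have "(\<Sum>i<d. ?\<beta> i) = ?\<beta> j + (\<Sum>i\<in>{..<d} - {j}. ?\<beta> i)"
    using assms(2) by (intro sum.remove) auto
  also have "(\<Sum>i\<in>{..<d} - {j}. ?\<beta> i) = (\<Sum>i\<in>{..<d} - {j}. \<alpha> i)"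
    by (intro sum.cong) auto
  also have "?\<beta> j + \<dots> = ?s + real k"
    using sum.remove[of "{..<d}" j \<alpha>] assms(2) by simp
  finally have sum: "(\<Sum>i<d. ?\<beta> i) = ?s + real k" .
  have "(\<Prod>i<d. Gamma (?\<beta> i)) = Gamma (?\<beta> j) * (\<Prod>i\<in>{..<d} - {j}. Gamma (?\<beta> i))"
    using assms(2) by (intro prod.remove) auto
  also have "(\<Prod>i\<in>{..<d} - {j}. Gamma (?\<beta> i)) = Q"
    unfolding Q_def by (intro prod.cong) auto
  finally have prod: "(\<Prod>i<d. Gamma (?\<beta> i)) = Gamma (\<alpha> j + real k) * Q" by simp
  have prod0: "(\<Prod>i<d. Gamma (\<alpha> i)) = Gamma (\<alpha> j) * Q"
    unfolding Q_def using assms(2) by (intro prod.remove) auto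
  have Q: "0 < Q" unfolding Q_def using assms by (intro prod_pos) (auto intro: Gamma_real_pos)
  have nz: "\<alpha> j \<notin> \<int>\<^sub>\<le>\<^sub>0" "?s \<notin> \<int>\<^sub>\<le>\<^sub>0" using j s by (auto elim!: nonpos_Ints_cases)
  have "0 < ?s + real k" using s by simp
  then show ?thesis
    unfolding multivariate_Beta_def sum prod prod0
    using Q Gamma_real_pos[OF s] Gamma_real_pos[OF j] Gamma_real_pos[of "?s + real k"]
    by (simp add: pochhammer_Gamma[OF nz(1)] pochhammer_Gamma[OF nz(2)] divide_simps)
qed

text \<open>The factor \<open>x j ^ k\<close> raises the j-th parameter of the density by k, so the
  moment is a quotient of two normalising constants.\<close>

lemma nn_integral_dirichlet:
  assumes "1 \<le> d" "\<And>i. i < d \<Longrightarrow> 0 < \<alpha> i" "j < d"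
  shows "(\<integral>\<^sup>+x. ennreal (x j ^ k) \<partial>dirichlet d \<alpha>) =
    ennreal (pochhammer (\<alpha> j) k / pochhammer (\<Sum>i<d. \<alpha> i) k)"
proof -
  let ?\<beta> = "\<alpha>(j := \<alpha> j + real k)"
  let ?f = "\<lambda>x. indicator (prob_simplex d) x * (1 / multivariate_Beta d \<alpha> * (\<Prod>i<d. x i powr (\<alpha> i - 1)))"
  let ?g = "\<lambda>x. indicator (prob_simplex d) x * (\<Prod>i<d. x i powr (?\<beta> i - 1))"
  have B: "0 < multivariate_Beta d \<alpha>" using multivariate_Beta_pos assms by simp
  have sets: "sets (hyperplane_lebesgue d) = sets (\<Pi>\<^sub>M i\<in>{..<d}. borel)"
    by (simp add: hyperplane_lebesgue_def)
  note [measurable_cong] = sets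
  have eq: "?f x * x j ^ k = 1 / multivariate_Beta d \<alpha> * ?g x" for x
  proof (cases "x \<in> prob_simplex d")
    case True
    then have "0 \<le> x j" using assms(3) by (auto simp: prob_simplex_def PiE_iff)
    then have xj: "x j powr (\<alpha> j - 1) * x j ^ k = x j powr (?\<beta> j - 1)"
      using powr_mult_power[of "x j" "\<alpha> j - 1" k] by (simp add: algebra_simps)
    have "(\<Prod>i<d. x i powr (?\<beta> i - 1)) =
        x j powr (?\<beta> j - 1) * (\<Prod>i\<in>{..<d} - {j}. x i powr (?\<beta> i - 1))"
      using assms(3) by (intro prod.remove) auto
    also have "(\<Prod>i\<in>{..<d} - {j}. x i powr (?\<beta> i - 1)) = (\<Prod>i\<in>{..<d} - {j}. x i powr (\<alpha> i - 1))"
      by (intro prod.cong) auto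
    also have "x j powr (?\<beta> j - 1) * \<dots> =
        x j powr (\<alpha> j - 1) * (\<Prod>i\<in>{..<d} - {j}. x i powr (\<alpha> i - 1)) * x j ^ k"
      unfolding xj[symmetric] by (simp only: mult_ac)
    also have "x j powr (\<alpha> j - 1) * (\<Prod>i\<in>{..<d} - {j}. x i powr (\<alpha> i - 1)) =
        (\<Prod>i<d. x i powr (\<alpha> i - 1))"
      using assms(3) by (intro prod.remove[symmetric]) auto
    finally show ?thesis using True by simp
  qed simp
  have "(\<integral>\<^sup>+x. ennreal (x j ^ k) \<partial>dirichlet d \<alpha>) =
      (\<integral>\<^sup>+x. ennreal (?f x) * ennreal (x j ^ k) \<partial>hyperplane_lebesgue d)"
    unfolding dirichlet_def using assms(3) by (subst nn_integral_density) auto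
  also have "\<dots> = (\<integral>\<^sup>+x. ennreal (1 / multivariate_Beta d \<alpha>) * ennreal (?g x) \<partial>hyperplane_lebesgue d)"
  proof (rule nn_integral_cong)
    fix x :: "nat \<Rightarrow> real"
    have "0 \<le> ?f x" using B by (intro mult_nonneg_nonneg prod_nonneg) auto
    moreover have "0 \<le> 1 / multivariate_Beta d \<alpha>" using B by simp
    ultimately show "ennreal (?f x) * ennreal (x j ^ k) =
        ennreal (1 / multivariate_Beta d \<alpha>) * ennreal (?g x)"
      by (simp only: eq flip: ennreal_mult')
  qed
  also have "\<dots> = ennreal (1 / multivariate_Beta d \<alpha>) *
      (\<integral>\<^sup>+x. ennreal (?g x) \<partial>hyperplane_lebesgue d)"
    by (rule nn_integral_cmult) measurable
  also have "\<dots> = ennreal (1 / multivariate_Beta d \<alpha>) * ennreal (multivariate_Beta d ?\<beta>)"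
    using assms by (subst nn_integral_hyperplane_lebesgue) (auto intro: add_pos_nonneg)
  also have "\<dots> = ennreal (multivariate_Beta d ?\<beta> / multivariate_Beta d \<alpha>)"
    using B by (simp flip: ennreal_mult')
  also have "\<dots> = ennreal (pochhammer (\<alpha> j) k / pochhammer (\<Sum>i<d. \<alpha> i) k)"
    using assms by (subst multivariate_Beta_ratio) auto
  finally show ?thesis .
qed

lemma sets_dirichlet [measurable_cong]: "sets (dirichlet d \<alpha>) = sets (\<Pi>\<^sub>M i\<in>{..<d}. borel)"
  by (simp add: dirichlet_def hyperplane_lebesgue_def)

lemma prob_space_dirichlet:
  assumes "1 \<le> d" "\<And>i. i < d \<Longrightarrow> 0 < \<alpha> i"
  shows "prob_space (dirichlet d \<alpha>)"
proof
  show "emeasure (dirichlet d \<alpha>) (space (dirichlet d \<alpha>)) = 1"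
    using nn_integral_dirichlet[of d \<alpha> 0 0] assms by simp
qed

lemma AE_dirichlet:
  assumes "i < d"
  shows "AE x in dirichlet d \<alpha>. 0 \<le> x i \<and> x i \<le> 1"
proof -
  have "(\<lambda>x. ennreal (indicator (prob_simplex d) x * (1 / multivariate_Beta d \<alpha> *
      (\<Prod>i<d. x i powr (\<alpha> i - 1))))) \<in> borel_measurable (hyperplane_lebesgue d)"
    unfolding hyperplane_lebesgue_def measurable_distr_eq1 by measurable
  then show ?thesis
    unfolding dirichlet_def using assms
    by (subst AE_density) (auto simp: indicator_def prob_simplex_def PiE_iff)
qed

lemma beta_moments_dirichlet:
  assumes "2 \<le> d" "\<And>i. i < d \<Longrightarrow> 0 < \<alpha> i" "i < d"
  shows "beta_moments (dirichlet d \<alpha>) (\<alpha> i) (\<Sum>i<d. \<alpha> i) (\<lambda>x. x i)"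
proof -
  interpret prob_space "dirichlet d \<alpha>" using prob_space_dirichlet[of d \<alpha>] assms by simp
  \<comment> \<open>As d >= 2, there is an index other than i, so the remaining parameters have
    positive sum and \<alpha> i lies strictly below the total.\<close>
  have "(if i = 0 then 1 else 0) \<in> {..<d} - {i}" using assms(1) by auto
  then have "{..<d} - {i} \<noteq> {}" by blast
  then have "0 < (\<Sum>j\<in>{..<d} - {i}. \<alpha> j)" using assms(2) by (intro sum_pos) auto
  then have "\<alpha> i < (\<Sum>i<d. \<alpha> i)" using sum.remove[of "{..<d}" i \<alpha>] assms(3) by simp
  then show ?thesis
    using assms AE_dirichlet[OF assms(3), of \<alpha>]
    by unfold_locales (simp_all add: nn_integral_dirichlet measurable_component_singleton)
qed

section \<open>Optimal proxy variances\<close>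

lemma is_optimal_proxy_variance_unique:
  "is_optimal_proxy_variance M X v \<Longrightarrow> is_optimal_proxy_variance M X w \<Longrightarrow> v = w"
  unfolding is_optimal_proxy_variance_def by (auto intro: antisym)

text \<open>This makes the definite description meaningful: existence comes from
  \<open>kummer_dominated_both_least\<close>, uniqueness from minimality.\<close>

lemma beta_optimal_proxy_variance_is_optimal:
  assumes "0 < a" "0 < b"
  shows "is_optimal_proxy_variance (beta_distribution a b) (\<lambda>x. x) (beta_optimal_proxy_variance a b)"
proof -
  interpret beta_moments "beta_distribution a b" a "a + b" "\<lambda>x. x"
    using beta_moments_beta_distribution[OF assms] .
  obtain v where "0 \<le> v" "kummer_dominated_both a (a + b) v"
    "\<And>w. kummer_dominated_both a (a + b) w \<Longrightarrow> v \<le> w"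
    using kummer_dominated_both_least[OF a_pos a_less] by blast
  then have opt: "is_optimal_proxy_variance (beta_distribution a b) (\<lambda>x. x) v"
    by (simp add: is_optimal_proxy_variance_def sub_gaussian_iff)
  show ?thesis
    unfolding beta_optimal_proxy_variance_def
    using opt by (rule theI) (rule is_optimal_proxy_variance_unique[OF _ opt])
qed

section \<open>From coordinates to vectors\<close>

text \<open>Convexity of exp, applied pointwise to the centred coordinates, bounds the exponential
  of the combination by the combination of exponentials; the same majorant gives
  integrability.\<close>

lemma sub_gaussian_convex_combination:
  assumes X: "\<And>i. i < d \<Longrightarrow> sub_gaussian M (\<lambda>\<omega>. X \<omega> i) v"
    and u: "u \<in> prob_simplex d"
  shows "sub_gaussian M (\<lambda>\<omega>. \<Sum>i<d. u i * X \<omega> i) v"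
proof -
  have u_nonneg: "0 \<le> u i" if "i < d" for i using u that by (auto simp: prob_simplex_def PiE_iff)
  have u_sum: "(\<Sum>i<d. u i) = 1" using u by (simp add: prob_simplex_def)
  then have "0 < d" by (cases d) auto
  then interpret prob_space M using X by (auto simp: sub_gaussian_def)
  have int: "integrable M (\<lambda>\<omega>. X \<omega> i)" if "i < d" for i
    using X[OF that] by (simp add: sub_gaussian_def)
  let ?Y = "\<lambda>\<omega>. \<Sum>i<d. u i * X \<omega> i"
  let ?\<mu> = "\<lambda>i. \<integral>\<omega>. X \<omega> i \<partial>M"
  have int_Y: "integrable M ?Y" using int by auto
  have mean: "integral\<^sup>L M ?Y = (\<Sum>i<d. u i * ?\<mu> i)"
    using int by (subst Bochner_Integration.integral_sum) auto
  let ?Z = "\<lambda>l \<omega>. \<Sum>i<d. u i * exp (l * (X \<omega> i - ?\<mu> i))"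
  have exp_int: "integrable M (\<lambda>\<omega>. exp (l * (X \<omega> i - ?\<mu> i)))"
    and exp_le: "(\<integral>\<omega>. exp (l * (X \<omega> i - ?\<mu> i)) \<partial>M) \<le> exp (l\<^sup>2 * v / 2)" if "i < d" for l i
    using X[OF that] by (simp_all add: sub_gaussian_def)
  have Z_int: "integrable M (?Z l)" for l using exp_int by auto
  have le: "exp (l * (?Y \<omega> - integral\<^sup>L M ?Y)) \<le> ?Z l \<omega>" for l \<omega>
  proof -
    have "l * (?Y \<omega> - integral\<^sup>L M ?Y) = (\<Sum>i<d. u i *\<^sub>R (l * (X \<omega> i - ?\<mu> i)))"
      unfolding mean by (simp add: sum_distrib_left algebra_simps flip: sum_subtractf)
    moreover have "exp (\<Sum>i<d. u i *\<^sub>R (l * (X \<omega> i - ?\<mu> i))) \<le> ?Z l \<omega>"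
      using u_nonneg u_sum \<open>0 < d\<close>
      by (intro convex_on_sum[OF _ _ exp_convex]) auto
    ultimately show ?thesis by simp
  qed
  have Y_int: "integrable M (\<lambda>\<omega>. exp (l * (?Y \<omega> - integral\<^sup>L M ?Y)))" for l
  proof (rule Bochner_Integration.integrable_bound[OF Z_int[of l]])
    show "AE \<omega> in M. norm (exp (l * (?Y \<omega> - integral\<^sup>L M ?Y))) \<le> norm (?Z l \<omega>)"
      using le[of l] by (intro AE_I2) (simp add: order_trans[OF _ abs_ge_self])
    show "(\<lambda>\<omega>. exp (l * (?Y \<omega> - integral\<^sup>L M ?Y))) \<in> borel_measurable M"
      using borel_measurable_integrable[OF int_Y] by measurable
  qed
  have "(\<integral>\<omega>. exp (l * (?Y \<omega> - integral\<^sup>L M ?Y)) \<partial>M) \<le> exp (l\<^sup>2 * v / 2)" for l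
  proof -
    have "(\<integral>\<omega>. exp (l * (?Y \<omega> - integral\<^sup>L M ?Y)) \<partial>M) \<le> integral\<^sup>L M (?Z l)"
      using Y_int Z_int le by (intro integral_mono) auto
    also have "\<dots> = (\<Sum>i<d. u i * (\<integral>\<omega>. exp (l * (X \<omega> i - ?\<mu> i)) \<partial>M))"
      using exp_int by (subst Bochner_Integration.integral_sum) auto
    also have "\<dots> \<le> (\<Sum>i<d. u i * exp (l\<^sup>2 * v / 2))"
      using exp_le u_nonneg by (intro sum_mono mult_left_mono) auto
    also have "\<dots> = exp (l\<^sup>2 * v / 2)" by (simp add: u_sum flip: sum_distrib_right)
    finally show ?thesis .
  qed
  then show ?thesis
    using Y_int int_Y prob_space_axioms by (simp add: sub_gaussian_def)
qed

text \<open>The vertices of the simplex pick out the coordinates, and every other direction is a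
  convex combination of them.\<close>

lemma sub_gaussian_vec_iff:
  "sub_gaussian_vec d M X v \<longleftrightarrow> prob_space M \<and> X \<in> measurable M (\<Pi>\<^sub>M i\<in>{..<d}. borel) \<and>
    (\<forall>i<d. sub_gaussian M (\<lambda>\<omega>. X \<omega> i) v)"
proof
  assume vec: "sub_gaussian_vec d M X v"
  have "sub_gaussian M (\<lambda>\<omega>. X \<omega> j) v" if "j < d" for j
  proof -
    let ?e = "\<lambda>i\<in>{..<d}. if i = j then 1 else 0 :: real"
    have "(\<Sum>i<d. ?e i) = (\<Sum>i<d. if i = j then 1 else 0)"
      by (intro sum.cong) auto
    then have "?e \<in> prob_simplex d"
      using that by (auto simp: prob_simplex_def)
    then have "sub_gaussian M (\<lambda>\<omega>. \<Sum>i<d. ?e i * X \<omega> i) v"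
      using vec unfolding sub_gaussian_vec_def by blast
    moreover have "(\<Sum>i<d. ?e i * X \<omega> i) = X \<omega> j" for \<omega>
    proof -
      have "(\<Sum>i<d. ?e i * X \<omega> i) = (\<Sum>i<d. if i = j then X \<omega> i else 0)"
        by (intro sum.cong) auto
      then show ?thesis using that by simp
    qed
    ultimately show ?thesis by simp
  qed
  then show "prob_space M \<and> X \<in> measurable M (\<Pi>\<^sub>M i\<in>{..<d}. borel) \<and>
      (\<forall>i<d. sub_gaussian M (\<lambda>\<omega>. X \<omega> i) v)"
    using vec by (simp add: sub_gaussian_vec_def)
next
  assume "prob_space M \<and> X \<in> measurable M (\<Pi>\<^sub>M i\<in>{..<d}. borel) \<and>
      (\<forall>i<d. sub_gaussian M (\<lambda>\<omega>. X \<omega> i) v)"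
  then show "sub_gaussian_vec d M X v"
    using sub_gaussian_convex_combination[of d M X v]
    by (simp add: sub_gaussian_vec_def) (simp add: sub_gaussian_def)
qed

theorem theorem3:
  fixes d :: nat and \<alpha> :: "nat \<Rightarrow> real" and \<alpha>_max \<alpha>_bar :: real
  assumes "d \<ge> 2"
    and "\<And>i. i < d \<Longrightarrow> \<alpha> i > 0"
    and "\<alpha>_max = Max (\<alpha> ` {..<d})"
    and "\<alpha>_bar = (\<Sum>i<d. \<alpha> i)"
  shows "is_optimal_proxy_variance (beta_distribution \<alpha>_max (\<alpha>_bar - \<alpha>_max)) (\<lambda>x. x)
           (beta_optimal_proxy_variance \<alpha>_max (\<alpha>_bar - \<alpha>_max)) \<and>
         is_optimal_proxy_variance_vec d (dirichlet d \<alpha>) (\<lambda>x. x)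
           (beta_optimal_proxy_variance \<alpha>_max (\<alpha>_bar - \<alpha>_max))"
proof -
  have "\<alpha>_max \<in> \<alpha> ` {..<d}"
    unfolding assms(3) using assms(1) by (intro Max_in) (auto simp: lessThan_empty_iff)
  then obtain m where m: "m < d" "\<alpha> m = \<alpha>_max" by auto
  have coord: "beta_moments (dirichlet d \<alpha>) (\<alpha> i) \<alpha>_bar (\<lambda>x. x i)" if "i < d" for i
    using beta_moments_dirichlet[of d \<alpha> i] assms that by simp
  interpret max: beta_moments "dirichlet d \<alpha>" \<alpha>_max \<alpha>_bar "\<lambda>x. x m"
    using coord[OF m(1)] m(2) by simp
  let ?b = "\<alpha>_bar - \<alpha>_max"
  have b: "0 < ?b" using max.a_less by simp
  interpret beta: beta_moments "beta_distribution \<alpha>_max ?b" \<alpha>_max \<alpha>_bar "\<lambda>x. x"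
    using beta_moments_beta_distribution[OF max.a_pos b] by simp
  have opt: "is_optimal_proxy_variance (beta_distribution \<alpha>_max ?b) (\<lambda>x. x)
      (beta_optimal_proxy_variance \<alpha>_max ?b)"
    using beta_optimal_proxy_variance_is_optimal[OF max.a_pos b] .
  \<comment> \<open>The Dirichlet vector and the Beta variable have the same set of proxy variances,
    hence the same minimum.\<close>
  have "sub_gaussian_vec d (dirichlet d \<alpha>) (\<lambda>x. x) v \<longleftrightarrow>
      sub_gaussian (beta_distribution \<alpha>_max ?b) (\<lambda>x. x) v" for v
  proof
    assume "sub_gaussian_vec d (dirichlet d \<alpha>) (\<lambda>x. x) v"
    then have "sub_gaussian (dirichlet d \<alpha>) (\<lambda>x. x m) v"
      using m(1) by (simp add: sub_gaussian_vec_iff)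
    then show "sub_gaussian (beta_distribution \<alpha>_max ?b) (\<lambda>x. x) v"
      by (simp add: max.sub_gaussian_iff beta.sub_gaussian_iff)
  next
    assume "sub_gaussian (beta_distribution \<alpha>_max ?b) (\<lambda>x. x) v"
    then have dom: "kummer_dominated_both \<alpha>_max \<alpha>_bar v" by (simp add: beta.sub_gaussian_iff)
    have "sub_gaussian (dirichlet d \<alpha>) (\<lambda>x. x i) v" if i: "i < d" for i
    proof -
      interpret i: beta_moments "dirichlet d \<alpha>" "\<alpha> i" \<alpha>_bar "\<lambda>x. x i" using coord[OF i] .
      have le: "\<alpha> i \<le> \<alpha>_max" unfolding assms(3) using i by (intro Max_ge) auto
      have "kummer_dominated_both (\<alpha> i) \<alpha>_bar v"
      proof (cases "i = m")
        \<comment> \<open>For two distinct indices, positivity of the parameters bounds the sum of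
          the two by the total, which is the side condition a + c <= s of the monotonicity
          lemma.\<close>
        case False
        have "(\<Sum>j\<in>{i, m}. \<alpha> j) \<le> \<alpha>_bar"
          unfolding assms(4) using i m(1) assms(2) by (intro sum_mono2) (auto intro: less_imp_le)
        then have "\<alpha> i + \<alpha>_max \<le> \<alpha>_bar" using False m(2) by simp
        then show ?thesis
          using kummer_dominated_both_antimono[OF i.a_pos le _ max.a_less dom] by simp
      qed (use dom m in simp)
      then show ?thesis by (simp add: i.sub_gaussian_iff)
    qed
    then show "sub_gaussian_vec d (dirichlet d \<alpha>) (\<lambda>x. x) v"
      using max.prob_space_axioms
      by (simp add: sub_gaussian_vec_iff measurable_ident_sets[OF sets_dirichlet])
  qed
  then show ?thesis
    using opt by (simp add: is_optimal_proxy_variance_def is_optimal_proxy_variance_vec_def)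
qed

end
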